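(* As formal power series in $x,y,z$, $$\sum_{n\ge 2}\ \sum_{2\le m<k\le 2n-1} f_{2n}(m,k)\,\frac{x^{2n-k-1}}{(2n-k-1)!}\,\frac{y^{k-m-1}}{(k-m-1)!}\,\frac{z^{m-2}}{(m-2)!}=\frac{\cos(2y)+2\cos(2(x-z))-\cos(2(z+x))}{2\cos^3(x+y+z)}.$$
   Context: An increasing tree of size $N$ is a planar binary tree with $N$ nodes labeled bijectively by $1,\dots,N$, the root labeled $1$, each node having $0$, $1$ or $2$ children, each child designated as a left child or a right child (at most one of each), and each node's label smaller than its children's labels. Its rightmost node is the node reached from the root by repeatedly moving to the right child until a node without right child is reached. The tree is complete if every node is either a leaf or has two children, except that when $N$ is even the rightmost node has exactly one child, which is a left child. Let $\mathfrak T_N$ be the set of complete increasing trees of size $N$. For $t\in\mathfrak T_N$: for a node $a$ with children, let $\min a$ be the smallest label of its children; the minimal chain is $a_1=1, a_2=\min a_1,\dots$, continued until a leaf $a_j$ is reached, and $\mathrm{eoc}(t):=a_j$. The node labeled $N$ is a leaf; $\mathrm{pom}(t)$ is the label of its parent. Set $f_{2n}(m,k):=\#\{t\in\mathfrak T_{2n}:\mathrm{eoc}(t)=m,\ \mathrm{pom}(t)=k\}$. *)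

theory Defs
  imports "HOL-Library.Tree" "HOL-Computational_Algebra.Formal_Power_Series"
begin

(* Planar binary trees are the library trees: the nodes are the Node constructors, Leaf is the
   empty tree (an absent child), and a leaf in the usual sense is Node Leaf a Leaf. *)

fun root_labels :: "'a tree \<Rightarrow> 'a set" where
  "root_labels Leaf = {}"
| "root_labels (Node l a r) = {a}"

definition child_labels :: "'a tree \<Rightarrow> 'a tree \<Rightarrow> 'a set" where
  "child_labels l r = root_labels l \<union> root_labels r"

(* N nodes whose labels exhaust {1..N}, so the labelling is a bijection. *)
definition increasing_tree :: "nat \<Rightarrow> nat tree \<Rightarrow> bool" where
  "increasing_tree N t \<longleftrightarrow>
     size t = N \<and> set_tree t = {1..N} \<and> root_labels t = {1} \<and>
     (\<forall>l a r. Node l a r \<in> subtrees t \<longrightarrow> (\<forall>b \<in> child_labels l r. a < b))"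

(* The subtree rooted at the rightmost node. *)
fun rightmost :: "'a tree \<Rightarrow> 'a tree" where
  "rightmost Leaf = Leaf"
| "rightmost (Node l a r) = (if r = Leaf then Node l a r else rightmost r)"

(* Nodes are identified with the subtrees they root, which is unambiguous for trees with
   pairwise distinct labels. *)
definition complete_tree :: "'a tree \<Rightarrow> bool" where
  "complete_tree t \<longleftrightarrow>
     (\<forall>l a r. Node l a r \<in> subtrees t \<longrightarrow>
        (if even (size t) \<and> Node l a r = rightmost t
         then l \<noteq> Leaf \<and> r = Leaf
         else l = Leaf \<longleftrightarrow> r = Leaf))"

definition complete_increasing_trees :: "nat \<Rightarrow> nat tree set" where
  "complete_increasing_trees N = {t. increasing_tree N t \<and> complete_tree t}"

(* Follow the child with the smallest label until a leaf is reached;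
   the value at the empty tree is irrelevant. *)
fun eoc :: "nat tree \<Rightarrow> nat" where
  "eoc Leaf = 0"
| "eoc (Node l a r) =
     (if l = Leaf \<and> r = Leaf then a
      else if Min (child_labels l r) \<in> root_labels l then eoc l
      else eoc r)"

(* For an increasing tree the maximal label is its size. *)
definition pom :: "nat tree \<Rightarrow> nat" where
  "pom t = (THE k. \<exists>l r. Node l k r \<in> subtrees t \<and> size t \<in> child_labels l r)"

definition eoc_pom_count :: "nat \<Rightarrow> nat \<Rightarrow> nat \<Rightarrow> nat" where
  "eoc_pom_count N m k =
     card {t \<in> complete_increasing_trees N. eoc t = m \<and> pom t = k}"

(* The ring R[[x,y,z]] as iterated univariate power series. *)
type_synonym fps3 = "real fps fps fps"

(* Coefficient of x^a y^b z^c. *)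
definition coeff3 :: "fps3 \<Rightarrow> nat \<Rightarrow> nat \<Rightarrow> nat \<Rightarrow> real" where
  "coeff3 F a b c = fps_nth (fps_nth (fps_nth F a) b) c"

definition X3 :: fps3 where "X3 = fps_X"
definition Y3 :: fps3 where "Y3 = fps_const fps_X"
definition Z3 :: fps3 where "Z3 = fps_const (fps_const fps_X)"

(* Substitution of U into a univariate series f, for U with zero constant term: U^i then has no
   terms of total degree below i, so the sum over all i may be cut off at a + b + c.
   The library composition would only be correct if U were divisible by x. *)
definition fps3_compose :: "real fps \<Rightarrow> fps3 \<Rightarrow> fps3" where
  "fps3_compose f U = Abs_fps (\<lambda>a. Abs_fps (\<lambda>b. Abs_fps (\<lambda>c.
     \<Sum>i = 0..a + b + c. fps_nth f i * coeff3 (U ^ i) a b c)))"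

definition cos3 :: "fps3 \<Rightarrow> fps3" where
  "cos3 U = fps3_compose (fps_cos 1) U"

(* S is the formal sum of the family F over I: every coefficient receives only finitely many
   nonzero contributions, and these add up to the coefficient of S. (The library topology on
   iterated power series only takes the outermost variable into account.) *)
definition fps3_has_sum :: "('i \<Rightarrow> fps3) \<Rightarrow> 'i set \<Rightarrow> fps3 \<Rightarrow> bool" where
  "fps3_has_sum F I S \<longleftrightarrow>
     (\<forall>a b c. finite {i \<in> I. coeff3 (F i) a b c \<noteq> 0} \<and>
        coeff3 S a b c = (\<Sum>i \<in> {i \<in> I. coeff3 (F i) a b c \<noteq> 0}. coeff3 (F i) a b c))"

end

theory Submission
  imports Defs "HOL-Library.Tree_Multiset"
begin

text \<open>
  Removing the labels 1, 2, 3, ... successively from a tree leaves forests consisting of one tree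
  that continues the rightmost path and j complete trees with an odd number of nodes. The smallest
  label is the root of one of these trees, and removing it turns j into j - 1 or j + 1. Hence the
  number of forests with a nodes is a! times the coefficient of x^a in tan(x)^j sec(x). The labels
  below m, between m and k, and above k form three phases of this process: before m the current end
  of the minimal chain is remembered, m closes the chain, and k multiplies the count by 2j + 1. The
  three phases are governed by linear differential equations in z, y and x, whose solutions for all
  j have a closed form in s = x + y + z; the case j = 0 is the asserted generating function.
\<close>

section \<open>Derivations of iterated power series\<close>

text \<open>The pending trees form an ordered list, and the subtrees freed by a removal always go to
  its front. A predicate blind to the order then keeps no trace of where the removed root stood, so
  its recursion closes up in the length alone. The statistic eoc breaks this symmetry only for one
  or two trees at the front. These are not counted by the index of the series: lists of length j + 1
  (chain still on the right path) belong to \<open>S_gf j\<close>, lists of length j + 2 (chain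
  inside a complete tree) to \<open>O_gf j\<close>. The obstacle is the factor 2j + 1 at k: it
  varies with j, so it is not multiplication by one series. It is an eigenvalue instead: sin(2s) f'
  + cos(2s) f = (2j + 1) f for f = tan(s)^j sec(s). To commute with the derivations in y and z, the
  operator needs coefficients free of y and z; \<open>mark\<close> therefore uses sin(2x) and
  cos(2x), which agree with sin(2s) and cos(2s) at y = z = 0, the only place where the eigenvalue
  equation is needed. All sizes N are treated at once; the restriction to even N enters only at the
  end, through parity.\<close>

locale derivation =
  fixes D :: "'a::comm_ring_1 \<Rightarrow> 'a"
  assumes add: "D (F + G) = D F + D G"
    and mult: "D (F * G) = F * D G + D F * G"
begin

lemma zero: "D 0 = 0"
  using add[of 0 0] by simp

lemma one: "D 1 = 0"
  using mult[of 1 1] by simp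

lemma uminus: "D (- F) = - D F"
  using add[of F "- F"] by (simp add: zero eq_neg_iff_add_eq_0 add.commute)

lemma diff: "D (F - G) = D F - D G"
  using add[of F "- G"] by (simp add: uminus)

lemma of_nat: "D (of_nat n) = 0"
  by (induction n) (simp_all add: zero one add)

lemma power: "D (F ^ n) = of_nat n * F ^ (n - 1) * D F"
proof (induction n)
  case (Suc n)
  then show ?case by (cases n) (simp_all add: mult algebra_simps)
qed (simp add: one)

lemma inverse:
  assumes "C * I = 1"
  shows "D I = - (I\<^sup>2 * D C)"
proof -
  have "C * D I + D C * I = 0"
    using mult[of C I] assms by (simp add: one)
  then have "I * (C * D I) = - (I * (D C * I))"
    by (metis distrib_left add_eq_0_iff2 mult_zero_right)
  moreover have "I * (C * D I) = D I"
    using assms by (metis mult.assoc mult.commute mult_1)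
  ultimately show ?thesis by (simp add: power2_eq_square algebra_simps)
qed

end

section \<open>Partial derivatives and coefficients in three variables\<close>

definition fps_map :: "('a \<Rightarrow> 'b) \<Rightarrow> 'a fps \<Rightarrow> 'b fps" where
  "fps_map h F = Abs_fps (\<lambda>n. h (fps_nth F n))"

lemma fps_map_nth [simp]: "fps_nth (fps_map h F) n = h (fps_nth F n)"
  by (simp add: fps_map_def)

lemma additive_sum:
  fixes h :: "'a::ab_group_add \<Rightarrow> 'b::ab_group_add"
  assumes "\<And>F G. h (F + G) = h F + h G"
  shows "h (sum f A) = (\<Sum>i\<in>A. h (f i))"
proof -
  have "h 0 = 0" using assms[of 0 0] by simp
  then show ?thesis by (induction A rule: infinite_finite_induct) (simp_all add: assms)
qed

lemma derivation_fps_map: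
  assumes "derivation D"
  shows "derivation (fps_map D)"
proof -
  interpret derivation D by fact
  show ?thesis
    by standard
      (simp_all add: fps_eq_iff add mult fps_mult_nth additive_sum[of D] sum.distrib)
qed

lemma fps_map_add:
  "(\<And>F G. h (F + G) = h F + h G) \<Longrightarrow> fps_map h (F + G) = fps_map h F + fps_map h G"
  by (simp add: fps_eq_iff)

lemma fps_map_mult:
  fixes h :: "'a::comm_ring_1 \<Rightarrow> 'b::comm_ring_1"
  assumes "\<And>F G. h (F + G) = h F + h G" "\<And>F G. h (F * G) = h F * h G"
  shows "fps_map h (F * G) = fps_map h F * fps_map h G"
  by (simp add: fps_eq_iff fps_mult_nth assms additive_sum[of h])

definition dx :: "fps3 \<Rightarrow> fps3" where "dx = fps_deriv"
definition dy :: "fps3 \<Rightarrow> fps3" where "dy = fps_map fps_deriv"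
definition dz :: "fps3 \<Rightarrow> fps3" where "dz = fps_map (fps_map fps_deriv)"

lemma derivation_fps_deriv: "derivation fps_deriv"
  by standard simp_all

interpretation dx: derivation dx
  unfolding dx_def by (rule derivation_fps_deriv)

interpretation dy: derivation dy
  unfolding dy_def by (intro derivation_fps_map derivation_fps_deriv)

interpretation dz: derivation dz
  unfolding dz_def by (intro derivation_fps_map derivation_fps_deriv)

lemma coeff3_dx: "coeff3 (dx F) a b c = real (a + 1) * coeff3 F (Suc a) b c"
proof -
  have "(of_nat n :: real fps fps) = fps_const (fps_const (of_nat n))" for n
    by (simp add: fps_of_nat)
  then show ?thesis by (simp add: coeff3_def dx_def del: of_nat_Suc)
qed

lemma coeff3_dy: "coeff3 (dy F) a b c = real (b + 1) * coeff3 F a (Suc b) c"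
proof -
  have "(of_nat n :: real fps) = fps_const (of_nat n)" for n
    by (simp add: fps_of_nat)
  then show ?thesis by (simp add: coeff3_def dy_def del: of_nat_Suc)
qed

lemma coeff3_dz: "coeff3 (dz F) a b c = real (c + 1) * coeff3 F a b (Suc c)"
  by (simp add: coeff3_def dz_def)

lemma coeff3_ext: "(\<And>a b c. coeff3 F a b c = coeff3 G a b c) \<Longrightarrow> F = G"
  by (simp add: coeff3_def fps_eq_iff)

lemma coeff3_add: "coeff3 (F + G) a b c = coeff3 F a b c + coeff3 G a b c"
  by (simp add: coeff3_def)

lemma coeff3_diff: "coeff3 (F - G) a b c = coeff3 F a b c - coeff3 G a b c"
  by (simp add: coeff3_def)

lemma coeff3_uminus: "coeff3 (- F) a b c = - coeff3 F a b c"
  by (simp add: coeff3_def)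

lemma coeff3_zero: "coeff3 0 a b c = 0"
  by (simp add: coeff3_def)

lemma coeff3_one: "coeff3 1 a b c = (if a = 0 \<and> b = 0 \<and> c = 0 then 1 else 0)"
  by (simp add: coeff3_def)

lemma coeff3_sum: "coeff3 (sum f A) a b c = (\<Sum>i\<in>A. coeff3 (f i) a b c)"
  by (simp add: coeff3_def fps_sum_nth)

lemma coeff3_0_mult: "coeff3 (F * G) 0 0 0 = coeff3 F 0 0 0 * coeff3 G 0 0 0"
  by (simp add: coeff3_def)

definition cst :: "real \<Rightarrow> fps3" where
  "cst r = fps_const (fps_const (fps_const r))"

lemma coeff3_cst_mult: "coeff3 (cst r * F) a b c = r * coeff3 F a b c"
  by (simp add: coeff3_def cst_def)

lemma coeff3_cst: "coeff3 (cst r) a b c = (if a = 0 \<and> b = 0 \<and> c = 0 then r else 0)"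
  by (auto simp add: coeff3_def cst_def)

lemma cst_arith:
  "cst (r + s) = cst r + cst s" "cst (r * s) = cst r * cst s" "cst (- r) = - cst r"
  "cst 0 = 0" "cst 1 = 1"
  by (simp_all add: cst_def)

lemma cst_of_nat: "cst (of_nat n) = of_nat n"
  by (induction n) (simp_all add: cst_arith)

lemma cst_numeral: "cst (numeral n) = numeral n"
  using cst_of_nat[of "numeral n"] by simp

lemma D_cst: "dx (cst r) = 0" "dy (cst r) = 0" "dz (cst r) = 0"
  by (rule coeff3_ext, simp add: coeff3_dx coeff3_dy coeff3_dz coeff3_cst,
      simp add: coeff3_def)+

lemma D_vars:
  "dx X3 = 1" "dy X3 = 0" "dz X3 = 0"
  "dx Y3 = 0" "dy Y3 = 1" "dz Y3 = 0"
  "dx Z3 = 0" "dy Z3 = 0" "dz Z3 = 1"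
  by (auto simp: dx_def dy_def dz_def X3_def Y3_def Z3_def fps_eq_iff fps_X_def)

section \<open>Trigonometric series of linear forms\<close>

definition lin :: "real \<Rightarrow> real \<Rightarrow> real \<Rightarrow> fps3" where
  "lin p q r = cst p * X3 + cst q * Y3 + cst r * Z3"

lemma D_lin: "dx (lin p q r) = cst p" "dy (lin p q r) = cst q" "dz (lin p q r) = cst r"
  by (simp_all add: lin_def dx.add dy.add dz.add dx.mult dy.mult dz.mult D_cst D_vars)

lemma coeff3_0_lin_power: "coeff3 (lin p q r ^ n) 0 0 0 = (if n = 0 then 1 else 0)"
  by (induction n)
    (simp_all add: coeff3_0_mult coeff3_def lin_def X3_def Y3_def Z3_def)

lemma coeff3_of_nat_mult: "coeff3 (of_nat n * F) a b c = real n * coeff3 F a b c"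
  using coeff3_cst_mult[of "real n" F a b c] by (simp add: cst_of_nat)

text \<open>The multinomial theorem, read off from d(U^(n+1)) = (n+1) U^n dU in a variable that
  occurs with positive exponent. Only the constant coefficient needs a separate argument.\<close>

lemma coeff3_lin_power:
  "coeff3 (lin p q r ^ n) a b c =
     (if a + b + c = n then fact n / (fact a * fact b * fact c) * p ^ a * q ^ b * r ^ c else 0)"
proof (induction n arbitrary: a b c)
  case 0
  then show ?case by (auto simp: coeff3_def)
next
  case (Suc n)
  let ?U = "lin p q r"
  have X: "real (a + 1) * coeff3 (?U ^ Suc n) (Suc a) b c
      = real (Suc n) * (p * coeff3 (?U ^ n) a b c)" for a b c
    using arg_cong[OF dx.power[of ?U "Suc n"], of "\<lambda>F. coeff3 F a b c"]
    by (simp add: coeff3_dx coeff3_of_nat_mult coeff3_cst_mult D_lin mult.assoc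
        mult.commute[of "?U ^ n"] del: of_nat_Suc power_Suc)
  have Y: "real (b + 1) * coeff3 (?U ^ Suc n) a (Suc b) c
      = real (Suc n) * (q * coeff3 (?U ^ n) a b c)" for a b c
    using arg_cong[OF dy.power[of ?U "Suc n"], of "\<lambda>F. coeff3 F a b c"]
    by (simp add: coeff3_dy coeff3_of_nat_mult coeff3_cst_mult D_lin mult.assoc
        mult.commute[of "?U ^ n"] del: of_nat_Suc power_Suc)
  have Z: "real (c + 1) * coeff3 (?U ^ Suc n) a b (Suc c)
      = real (Suc n) * (r * coeff3 (?U ^ n) a b c)" for a b c
    using arg_cong[OF dz.power[of ?U "Suc n"], of "\<lambda>F. coeff3 F a b c"]
    by (simp add: coeff3_dz coeff3_of_nat_mult coeff3_cst_mult D_lin mult.assoc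
        mult.commute[of "?U ^ n"] del: of_nat_Suc power_Suc)
  consider (x) a' where "a = Suc a'" | (y) b' where "b = Suc b'" | (z) c' where "c = Suc c'"
    | (o) "a = 0" "b = 0" "c = 0"
    by (metis nat.exhaust)
  then show ?case
  proof cases
    case x
    have *: "real (Suc a') \<noteq> 0" by simp
    have "coeff3 (?U ^ Suc n) a b c = real (Suc n) * (p * coeff3 (?U ^ n) a' b c) / real (Suc a')"
      using X[of a' b c] * by (simp add: x field_simps del: of_nat_Suc power_Suc)
    then show ?thesis by (auto simp: Suc.IH x simp del: of_nat_Suc power_Suc)
        (auto simp: field_simps)
  next
    case y
    have *: "real (Suc b') \<noteq> 0" by simp
    have "coeff3 (?U ^ Suc n) a b c = real (Suc n) * (q * coeff3 (?U ^ n) a b' c) / real (Suc b')"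
      using Y[of b' a c] * by (simp add: y field_simps del: of_nat_Suc power_Suc)
    then show ?thesis by (auto simp: Suc.IH y simp del: of_nat_Suc power_Suc)
        (auto simp: field_simps)
  next
    case z
    have *: "real (Suc c') \<noteq> 0" by simp
    have "coeff3 (?U ^ Suc n) a b c = real (Suc n) * (r * coeff3 (?U ^ n) a b c') / real (Suc c')"
      using Z[of c' a b] * by (simp add: z field_simps del: of_nat_Suc power_Suc)
    then show ?thesis by (auto simp: Suc.IH z simp del: of_nat_Suc power_Suc)
        (auto simp: field_simps)
  next
    case o
    then show ?thesis by (simp add: coeff3_0_lin_power del: power_Suc)
  qed
qed

section \<open>Composition of univariate series with linear forms\<close>

definition lcomp :: "real fps \<Rightarrow> real \<Rightarrow> real \<Rightarrow> real \<Rightarrow> fps3" where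
  "lcomp f p q r = fps3_compose f (lin p q r)"

text \<open>Powers of a linear form are homogeneous, so of the truncated sum in
  \<open>fps3_compose\<close> only its last term i = a + b + c survives.\<close>

lemma coeff3_lcomp:
  "coeff3 (lcomp f p q r) a b c =
     fps_nth f (a + b + c) * fact (a + b + c) / (fact a * fact b * fact c) * p ^ a * q ^ b * r ^ c"
proof -
  have "coeff3 (lcomp f p q r) a b c =
      (\<Sum>i = 0..a + b + c. if i = a + b + c then fps_nth f i *
         (fact i / (fact a * fact b * fact c) * p ^ a * q ^ b * r ^ c) else 0)"
    unfolding lcomp_def fps3_compose_def
    by (subst coeff3_def, unfold fps_nth_Abs_fps, intro sum.cong) (auto simp: coeff3_lin_power)
  then show ?thesis by (simp add: sum.delta)
qed

lemma D_lcomp: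
  "dx (lcomp f p q r) = cst p * lcomp (fps_deriv f) p q r"
  "dy (lcomp f p q r) = cst q * lcomp (fps_deriv f) p q r"
  "dz (lcomp f p q r) = cst r * lcomp (fps_deriv f) p q r"
  by (rule coeff3_ext,
      simp add: coeff3_dx coeff3_dy coeff3_dz coeff3_cst_mult coeff3_lcomp del: of_nat_Suc,
      simp add: field_simps del: of_nat_Suc)+

abbreviation lcos :: "real \<Rightarrow> real \<Rightarrow> real \<Rightarrow> fps3" where "lcos \<equiv> lcomp (fps_cos 1)"
abbreviation lsin :: "real \<Rightarrow> real \<Rightarrow> real \<Rightarrow> fps3" where "lsin \<equiv> lcomp (fps_sin 1)"

lemma lcomp_uminus: "lcomp (- f) p q r = - lcomp f p q r"
  by (rule coeff3_ext) (simp add: coeff3_lcomp coeff3_uminus)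

lemma fps_deriv_trig: "fps_deriv (fps_cos 1) = - fps_sin (1::real)"
  "fps_deriv (fps_sin 1) = fps_cos (1::real)"
  by (simp_all add: fps_cos_deriv fps_sin_deriv flip: fps_const_neg)

lemmas D_trig = D_lcomp[of "fps_cos 1", unfolded fps_deriv_trig lcomp_uminus]
  D_lcomp[of "fps_sin 1", unfolded fps_deriv_trig]

lemma coeff3_0_trig: "coeff3 (lcos p q r) 0 0 0 = 1" "coeff3 (lsin p q r) 0 0 0 = 0"
  by (simp_all add: coeff3_lcomp)

text \<open>Applied to the difference of the two sides, this gives the addition formulas.\<close>

lemma rotation_system_unique:
  assumes "dx P = cst p * Q" "dy P = cst q * Q" "dz P = cst r * Q"
    and "dx Q = - (cst p * P)" "dy Q = - (cst q * P)" "dz Q = - (cst r * P)"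
    and "coeff3 P 0 0 0 = 0" "coeff3 Q 0 0 0 = 0"
  shows "P = 0 \<and> Q = 0"
proof -
  have R: "dx P = cst p * Q" "dy P = cst q * Q" "dz P = cst r * Q"
    "dx Q = cst (- p) * P" "dy Q = cst (- q) * P" "dz Q = cst (- r) * P"
    using assms by (simp_all add: cst_arith)
  have E: "coeff3 P (Suc a) b c = p * coeff3 Q a b c / (a + 1)"
    "coeff3 Q (Suc a) b c = - p * coeff3 P a b c / (a + 1)"
    "coeff3 P a (Suc b) c = q * coeff3 Q a b c / (b + 1)"
    "coeff3 Q a (Suc b) c = - q * coeff3 P a b c / (b + 1)"
    "coeff3 P a b (Suc c) = r * coeff3 Q a b c / (c + 1)"
    "coeff3 Q a b (Suc c) = - r * coeff3 P a b c / (c + 1)" for a b c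
    using R[THEN arg_cong, of "\<lambda>F. coeff3 F a b c"]
    by (simp_all only: coeff3_dx coeff3_dy coeff3_dz coeff3_cst_mult)
      (simp_all add: field_simps)
  have "coeff3 P a b c = 0 \<and> coeff3 Q a b c = 0" for a b c
  proof (induction "a + b + c" arbitrary: a b c)
    case 0
    then show ?case using assms by simp
  next
    case (Suc n)
    then consider (x) a' where "a = Suc a'" "n = a' + b + c"
      | (y) b' where "b = Suc b'" "n = a + b' + c" | (z) c' where "c = Suc c'" "n = a + b + c'"
      by (metis add_Suc add_Suc_right add_is_0 nat.exhaust nat.inject nat.distinct(1))
    then show ?case using Suc(1) by cases (auto simp: E)
  qed
  then show ?thesis by (simp add: coeff3_ext coeff3_zero)
qed

lemma lsin_lcos_add:
  "lsin (p + p') (q + q') (r + r') = lsin p q r * lcos p' q' r' + lcos p q r * lsin p' q' r'"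
  "lcos (p + p') (q + q') (r + r') = lcos p q r * lcos p' q' r' - lsin p q r * lsin p' q' r'"
proof -
  let ?P = "lsin (p + p') (q + q') (r + r') - (lsin p q r * lcos p' q' r' + lcos p q r * lsin p' q' r')"
  let ?Q = "lcos (p + p') (q + q') (r + r') - (lcos p q r * lcos p' q' r' - lsin p q r * lsin p' q' r')"
  have "?P = 0 \<and> ?Q = 0"
    by (rule rotation_system_unique[where p = "p + p'" and q = "q + q'" and r = "r + r'"])
      (simp_all add: dx.add dy.add dz.add dx.diff dy.diff dz.diff dx.mult dy.mult dz.mult D_trig
        cst_arith coeff3_diff coeff3_add coeff3_0_mult coeff3_0_trig, simp_all add: algebra_simps)
  then show "lsin (p + p') (q + q') (r + r') = lsin p q r * lcos p' q' r' + lcos p q r * lsin p' q' r'"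
    "lcos (p + p') (q + q') (r + r') = lcos p q r * lcos p' q' r' - lsin p q r * lsin p' q' r'"
    by simp_all
qed

lemma lsin_lcos_uminus: "lsin (- p) (- q) (- r) = - lsin p q r" "lcos (- p) (- q) (- r) = lcos p q r"
proof -
  \<comment> \<open>The order of subtraction in \<open>?Q\<close> is chosen so that
    d\<open>?P\<close> = p \<open>?Q\<close> and d\<open>?Q\<close> = - p \<open>?P\<close>, the
    signs that the uniqueness lemma expects.\<close>
  let ?P = "lsin (- p) (- q) (- r) + lsin p q r" and ?Q = "lcos p q r - lcos (- p) (- q) (- r)"
  have "?P = 0 \<and> ?Q = 0"
    by (rule rotation_system_unique[where p = p and q = q and r = r])
      (simp_all add: dx.add dy.add dz.add dx.diff dy.diff dz.diff D_trig
        cst_arith coeff3_diff coeff3_add coeff3_0_trig, simp_all add: algebra_simps)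
  then show "lsin (- p) (- q) (- r) = - lsin p q r" "lcos (- p) (- q) (- r) = lcos p q r"
    by (simp_all add: eq_neg_iff_add_eq_0)
qed

lemma lcos_zero: "lcos 0 0 0 = 1"
  by (rule coeff3_ext) (auto simp: coeff3_lcomp coeff3_one)

lemma lcos2_lsin2: "lcos p q r ^ 2 + lsin p q r ^ 2 = 1"
  using lsin_lcos_add(2)[of p "- p" q "- q" r "- r"]
  by (simp add: lsin_lcos_uminus lcos_zero power2_eq_square)

section \<open>The generating functions of the labelled forests\<close>

definition sec_s :: fps3 where "sec_s = inverse (lcos 1 1 1)"
definition tan_s :: fps3 where "tan_s = lsin 1 1 1 * sec_s"

text \<open>Stated over a ring of coefficients so that it can be applied once per variable, from the
  outermost inwards, down to the real constant coefficient.\<close>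

lemma fps_unit_mult_inverse:
  fixes F :: "'a::{comm_ring_1,inverse} fps"
  assumes "fps_nth F 0 * inverse (fps_nth F 0) = 1"
  shows "F * inverse F = 1"
  unfolding fps_inverse_def using assms by (rule fps_right_inverse)

lemma fps3_unit:
  assumes "coeff3 F 0 0 0 \<noteq> 0"
  shows "F * inverse F = 1"
  using assms by (intro fps_unit_mult_inverse) (simp add: coeff3_def)

text \<open>Division of power series involves a shift by the subdegree of the divisor in x. A
  nonzero constant coefficient makes this subdegree 0, and the quotient becomes a product with the
  inverse.\<close>

lemma fps3_divide_eq:
  fixes F G H :: fps3
  assumes "H * G = F" "coeff3 G 0 0 0 \<noteq> 0"
  shows "F / G = H"
proof -
  have "fps_nth G 0 \<noteq> 0" using assms(2) by (auto simp: coeff3_def)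
  then have "subdegree G = 0" by (simp add: subdegree_eq_0_iff)
  then have "F / G = F * inverse G" by (simp add: fps_divide_def)
  also have "\<dots> = H * (G * inverse G)" using assms(1) by (simp add: mult.assoc)
  finally show ?thesis using fps3_unit[OF assms(2)] by simp
qed

lemma cos_sec: "lcos 1 1 1 * sec_s = 1"
  unfolding sec_s_def by (rule fps3_unit) (simp add: coeff3_0_trig)

lemma cos_tan: "lcos 1 1 1 * tan_s = lsin 1 1 1"
  using cos_sec by (simp add: tan_s_def mult.left_commute)

lemma (in derivation) sec_tan:
  fixes C S I :: 'a
  assumes "C * I = 1" "C ^ 2 + S ^ 2 = 1" "D C = - S" "D S = C"
  shows "D I = (S * I) * I" "D (S * I) = 1 + (S * I) ^ 2"
proof -
  show "D I = (S * I) * I"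
    using inverse[OF assms(1)] by (simp add: assms power2_eq_square mult_ac)
  then show "D (S * I) = 1 + (S * I) ^ 2"
    using assms by (simp add: mult power2_eq_square mult_ac)
qed

lemmas D_sec_tan =
  dx.sec_tan[of "lcos 1 1 1" sec_s "lsin 1 1 1", OF cos_sec lcos2_lsin2, folded tan_s_def]
  dy.sec_tan[of "lcos 1 1 1" sec_s "lsin 1 1 1", OF cos_sec lcos2_lsin2, folded tan_s_def]
  dz.sec_tan[of "lcos 1 1 1" sec_s "lsin 1 1 1", OF cos_sec lcos2_lsin2, folded tan_s_def]

lemma D_tan_sec:
  "dx sec_s = tan_s * sec_s" "dy sec_s = tan_s * sec_s" "dz sec_s = tan_s * sec_s"
  "dx tan_s = 1 + tan_s ^ 2" "dy tan_s = 1 + tan_s ^ 2" "dz tan_s = 1 + tan_s ^ 2"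
  by (rule D_sec_tan; simp add: D_trig cst_arith)+

text \<open>Only the coefficients at y = z = 0 count forests. The argument x + y + z instead of x
  makes the derivative in y act like the one in x, so the phase between m and k inherits the same
  recursion.\<close>

definition X_gf :: "nat \<Rightarrow> fps3" where "X_gf j = tan_s ^ j * sec_s"

text \<open>At j = 0 the truncated exponent j - 1 is harmless because of the factor j; the
  recursions below rely on the same convention.\<close>

lemma (in derivation) power_tan:
  assumes "D T = 1 + T ^ 2"
  shows "D (T ^ j) = of_nat j * (T ^ (j - 1) + T ^ (j + 1))"
proof (cases j)
  case (Suc n)
  then show ?thesis
    unfolding power assms by (simp add: algebra_simps power2_eq_square)
qed (simp add: one)

lemmas D_tan_power =
  dx.power_tan[OF D_tan_sec(4)] dy.power_tan[OF D_tan_sec(5)] dz.power_tan[OF D_tan_sec(6)]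

lemma D_X_gf:
  "dx (X_gf j) = of_nat j * X_gf (j - 1) + of_nat (j + 1) * X_gf (j + 1)"
  "dy (X_gf j) = of_nat j * X_gf (j - 1) + of_nat (j + 1) * X_gf (j + 1)"
  by (simp_all add: X_gf_def dx.mult dy.mult D_tan_power D_tan_sec algebra_simps)

text \<open>Choosing the parent k of the last node multiplies the j-th series at y = z = 0 by 2j + 1
  (\<open>ev_yz_Y_gf\<close>). The operator below extends this to all y and z and commutes with the
  derivations in y and z, so the recursions before k keep their form.\<close>

definition mark :: "fps3 \<Rightarrow> fps3" where
  "mark F = lsin 2 0 0 * dy F + lcos 2 0 0 * F"

lemma D_mark: "dy (mark F) = mark (dy F)" "dz (mark F) = mark (dz F)"
proof -
  have "dz (dy F) = dy (dz F)"
    by (rule coeff3_ext) (simp add: coeff3_dy coeff3_dz)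
  then show "dy (mark F) = mark (dy F)" "dz (mark F) = mark (dz F)"
    by (simp_all add: mark_def dy.add dy.mult dz.add dz.mult D_trig cst_arith)
qed

lemma mark_add: "mark (F + G) = mark F + mark G"
  by (simp add: mark_def dy.add algebra_simps)

lemma mark_of_nat: "mark (of_nat n * F) = of_nat n * mark F"
  by (simp add: mark_def dy.mult dy.of_nat algebra_simps)

definition Y_gf :: "nat \<Rightarrow> fps3" where "Y_gf j = mark (X_gf j)"

text \<open>Closed solutions of the recursions \<open>dz_S_gf\<close> and \<open>dz_O_gf\<close>, found by integrating the
  corresponding transport equations along characteristics.\<close>

definition S_gf :: "nat \<Rightarrow> fps3" where
  "S_gf j = mark (tan_s ^ j * lcos 1 1 (- 1) * sec_s ^ 2)"

definition O_gf :: "nat \<Rightarrow> fps3" where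
  "O_gf j = mark (tan_s ^ j * lsin 2 2 0 * sec_s ^ 3)"

lemma dy_Y_gf: "dy (Y_gf j) = of_nat j * Y_gf (j - 1) + of_nat (j + 1) * Y_gf (j + 1)"
  unfolding Y_gf_def D_mark D_X_gf mark_add mark_of_nat ..

text \<open>Put K = cos(x + y - z). The factor sec^2 contributes 2 tan(s) K to the derivative, while
  the homogeneous recursion absorbs only one tan(s) K. The surplus tan(s) K + sin(x + y - z) equals
  sin(2x + 2y) sec(s), since 2x + 2y = (x + y - z) + s, and this is the source
  \<open>O_gf j\<close>.\<close>

lemma dz_S_gf: "dz (S_gf j) = of_nat j * S_gf (j - 1) + of_nat (j + 1) * S_gf (j + 1) + O_gf j"
proof -
  let ?k = "lcos 1 1 (- 1)" and ?l = "lsin 1 1 (- 1)"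
  have "lsin 2 2 0 = ?l * lcos 1 1 1 + ?k * lsin 1 1 1"
    using lsin_lcos_add(1)[of 1 1 1 1 "-1" 1] by simp
  then have "lsin 2 2 0 * sec_s = ?l * (lcos 1 1 1 * sec_s) + ?k * tan_s"
    by (simp add: tan_s_def algebra_simps)
  then have *: "lsin 2 2 0 * sec_s = ?l + ?k * tan_s"
    by (simp add: cos_sec)
  have "dz (tan_s ^ j * ?k * sec_s ^ 2) =
      of_nat j * (tan_s ^ (j - 1) * ?k * sec_s ^ 2 + tan_s ^ (j + 1) * ?k * sec_s ^ 2)
      + tan_s ^ j * ?l * sec_s ^ 2 + 2 * (tan_s ^ (j + 1) * ?k * sec_s ^ 2)"
    by (simp add: dz.mult D_tan_power D_tan_sec D_trig cst_arith power2_eq_square algebra_simps)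
  also have "\<dots> = of_nat j * (tan_s ^ (j - 1) * ?k * sec_s ^ 2)
      + of_nat (j + 1) * (tan_s ^ (j + 1) * ?k * sec_s ^ 2)
      + tan_s ^ j * (?l + ?k * tan_s) * sec_s ^ 2"
    by (simp add: algebra_simps)
  also have "tan_s ^ j * (?l + ?k * tan_s) * sec_s ^ 2 = tan_s ^ j * lsin 2 2 0 * sec_s ^ 3"
    by (simp add: power2_eq_square power3_eq_cube flip: *)
  finally show ?thesis
    unfolding S_gf_def O_gf_def D_mark by (simp only: mark_add mark_of_nat)
qed

text \<open>The 3 in j + 3 is the exponent of sec. The factor sin(2x + 2y) is constant in z and so
  remains free to fit the initial value at z = 0.\<close>

lemma dz_O_gf: "dz (O_gf j) = of_nat j * O_gf (j - 1) + of_nat (j + 3) * O_gf (j + 1)"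
proof -
  have "dz (tan_s ^ j * lsin 2 2 0 * sec_s ^ 3) =
      of_nat j * (tan_s ^ (j - 1) * lsin 2 2 0 * sec_s ^ 3)
      + of_nat (j + 3) * (tan_s ^ (j + 1) * lsin 2 2 0 * sec_s ^ 3)"
    by (simp add: dz.mult D_tan_power D_tan_sec D_trig cst_arith power3_eq_cube algebra_simps)
  then show ?thesis
    unfolding O_gf_def D_mark by (simp only: mark_add mark_of_nat)
qed

section \<open>Initial values at z = 0 and at y = z = 0\<close>

definition ev_z :: "fps3 \<Rightarrow> real fps fps" where
  "ev_z = fps_map (fps_map (\<lambda>f. fps_nth f 0))"

definition ev_yz :: "fps3 \<Rightarrow> real fps" where
  "ev_yz = fps_map (\<lambda>f. fps_nth (fps_nth f 0) 0)"

lemma ev_z_ring: "ev_z (F + G) = ev_z F + ev_z G" "ev_z (F * G) = ev_z F * ev_z G"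
  unfolding ev_z_def by (intro fps_map_add fps_map_mult; simp add: fps_map_add fps_map_mult)+

lemma ev_yz_ring:
  "ev_yz (F + G) = ev_yz F + ev_yz G" "ev_yz (F * G) = ev_yz F * ev_yz G"
  unfolding ev_yz_def by (simp_all add: fps_map_add fps_map_mult)

lemma ev_z_eq_iff: "ev_z F = ev_z G \<longleftrightarrow> (\<forall>a b. coeff3 F a b 0 = coeff3 G a b 0)"
  by (auto simp: ev_z_def fps_eq_iff coeff3_def)

lemma ev_yz_eq_iff: "ev_yz F = ev_yz G \<longleftrightarrow> (\<forall>a. coeff3 F a 0 0 = coeff3 G a 0 0)"
  by (auto simp: ev_yz_def fps_eq_iff coeff3_def)

lemma ev_lcomp:
  "ev_z (lcomp f p q r) = ev_z (lcomp f p q r')"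
  "ev_yz (lcomp f p q r) = ev_yz (lcomp f p q' r')"
  by (simp_all add: ev_z_eq_iff ev_yz_eq_iff coeff3_lcomp)

text \<open>\<open>mark\<close> differentiates in y only, so it respects equality at z = 0. It does
  not respect equality at y = 0, which is why \<open>ev_yz_Y_gf\<close> needs its own
  computation.\<close>

lemma ev_z_mark:
  assumes "ev_z F = ev_z G"
  shows "ev_z (mark F) = ev_z (mark G)"
proof -
  have "ev_z (dy F) = ev_z (dy G)"
    using assms by (simp add: ev_z_eq_iff coeff3_dy)
  then show ?thesis using assms by (simp add: mark_def ev_z_ring)
qed

lemma sin2_cos2_s:
  "lsin 2 2 2 = 2 * (lsin 1 1 1 * lcos 1 1 1)" "lcos 2 2 2 = lcos 1 1 1 ^ 2 - lsin 1 1 1 ^ 2"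
  using lsin_lcos_add[of 1 1 1 1 1 1] by (simp_all add: power2_eq_square mult.commute)

text \<open>At z = 0 the factor cos(x + y - z) turns into cos(s) and cancels one of the two factors
  sec(s).\<close>

lemma ev_z_S_gf: "ev_z (S_gf j) = ev_z (Y_gf j)"
proof -
  have *: "lcos 1 1 1 * (tan_s ^ j * sec_s ^ 2) = X_gf j"
    using cos_sec by (simp add: X_gf_def power2_eq_square)
  have "ev_z (tan_s ^ j * lcos 1 1 (- 1) * sec_s ^ 2) = ev_z (X_gf j)"
    unfolding *[symmetric] ev_z_ring(2) ev_lcomp(1)[of "fps_cos 1" 1 1 "- 1" 1] by (simp add: mult_ac)
  then show ?thesis unfolding S_gf_def Y_gf_def by (rule ev_z_mark)
qed

text \<open>At z = 0, sin(2x + 2y) becomes 2 sin(s) cos(s), which leaves 2 tan(s)^(j+1) sec(s).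
  Combinatorially, the 2 says that either tree of the distinguished pair may be the leaf m.\<close>

lemma ev_z_O_gf: "ev_z (O_gf j) = ev_z (2 * Y_gf (j + 1))"
proof -
  have "lsin 2 2 2 * (tan_s ^ j * sec_s ^ 3) = 2 * ((lcos 1 1 1 * sec_s) * (lsin 1 1 1 * sec_s) * (tan_s ^ j * sec_s))"
    by (simp add: sin2_cos2_s power3_eq_cube mult_ac)
  also have "\<dots> = 2 * X_gf (j + 1)"
    by (simp add: cos_sec X_gf_def flip: tan_s_def)
  finally have *: "lsin 2 2 2 * (tan_s ^ j * sec_s ^ 3) = 2 * X_gf (j + 1)" .
  have "ev_z (tan_s ^ j * lsin 2 2 0 * sec_s ^ 3) = ev_z (2 * X_gf (j + 1))"
    unfolding *[symmetric] ev_z_ring(2) ev_lcomp(1)[of "fps_sin 1" 2 2 0 2] by (simp add: mult_ac)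
  then have "ev_z (O_gf j) = ev_z (mark (2 * X_gf (j + 1)))"
    unfolding O_gf_def by (rule ev_z_mark)
  then show ?thesis using mark_of_nat[of 2 "X_gf (j + 1)"] by (simp add: Y_gf_def)
qed

text \<open>For f = T^j sec(s) with T = tan(s), the logarithmic derivative is j (1 + T^2) / T + T.
  Multiplied by sin(2s) it gives 2j + 2 sin(s)^2, and adding cos(2s) = 1 - 2 sin(s)^2 leaves 2j +
  1.\<close>

lemma ev_yz_Y_gf: "ev_yz (Y_gf j) = ev_yz (of_nat (2 * j + 1) * X_gf j)"
proof -
  let ?c = "lcos 1 1 1" and ?s = "lsin 1 1 1"
  have st: "?s * ?s = ?s * ?c * tan_s"
    using cos_tan by (simp add: mult.assoc)
  have *: "of_nat j * (?s * tan_s ^ (j - 1)) = of_nat j * (?c * tan_s ^ j)"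
    by (cases j) (simp_all flip: cos_tan)
  have "lsin 2 2 2 * dy (X_gf j) + lcos 2 2 2 * X_gf j =
      2 * ?c * (of_nat j * (?s * tan_s ^ (j - 1))) * sec_s
      + 2 * of_nat (j + 1) * (?s * (?c * tan_s)) * X_gf j + (?c ^ 2 - ?s ^ 2) * X_gf j"
    unfolding D_X_gf sin2_cos2_s by (simp add: X_gf_def algebra_simps)
  also have "\<dots> = (2 * of_nat j * (?c ^ 2 + ?s ^ 2) + (?c ^ 2 + ?s ^ 2)) * X_gf j"
    unfolding * cos_tan by (simp add: X_gf_def algebra_simps power2_eq_square)
  also have "\<dots> = of_nat (2 * j + 1) * X_gf j"
    by (simp add: lcos2_lsin2)
  finally have "ev_yz (lsin 2 2 2 * dy (X_gf j) + lcos 2 2 2 * X_gf j) = ev_yz (of_nat (2 * j + 1) * X_gf j)"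
    by (rule arg_cong)
  then show ?thesis
    unfolding Y_gf_def mark_def ev_yz_ring(1,2)
      ev_lcomp(2)[of "fps_sin 1" 2 0 0 2 2] ev_lcomp(2)[of "fps_cos 1" 2 0 0 2 2] .
qed

text \<open>Once the denominator is cleared, every angle is written through s, 2x and 2z, by x + y -
  z = s - 2z and 2y = 2s - (2x + 2z).\<close>

lemma S_gf_0:
  "S_gf 0 * (2 * lcos 1 1 1 ^ 3) = lcos 0 2 0 + 2 * lcos 2 0 (- 2) - lcos 2 0 2"
proof -
  let ?c = "lcos 1 1 1" and ?s = "lsin 1 1 1" and ?k = "lcos 1 1 (- 1)" and ?l = "lsin 1 1 (- 1)"
  let ?a = "lcos 2 0 0" and ?b = "lsin 2 0 0" and ?d = "lcos 0 0 2" and ?e = "lsin 0 0 2"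
  have "S_gf 0 = ?b * (2 * ?k * tan_s * sec_s ^ 2 - ?l * sec_s ^ 2) + ?a * ?k * sec_s ^ 2"
    by (simp add: S_gf_def mark_def dy.mult D_trig D_tan_sec cst_arith power2_eq_square algebra_simps)
  then have "S_gf 0 * (2 * ?c ^ 3) =
      (?b * (2 * ?k * tan_s * sec_s ^ 2 - ?l * sec_s ^ 2) + ?a * ?k * sec_s ^ 2) * (2 * ?c ^ 3)"
    by (rule arg_cong)
  also have "\<dots> =
      2 * (?c * sec_s) ^ 2 * (?b * (2 * ?k * (?c * tan_s) - ?l * ?c) + ?a * ?k * ?c)"
    by (simp add: power2_eq_square power3_eq_cube algebra_simps)
  finally have S: "S_gf 0 * (2 * ?c ^ 3) = 2 * (?b * (2 * ?k * ?s - ?l * ?c) + ?a * ?k * ?c)"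
    by (simp add: cos_sec cos_tan)
  have kl: "?k = ?c * ?d + ?s * ?e" "?l = ?s * ?d - ?c * ?e"
    using lsin_lcos_add[of 1 0 1 0 1 "-2"] lsin_lcos_uminus[of 0 0 2] by simp_all
  have 1: "lcos 2 0 (- 2) = ?a * ?d + ?b * ?e"
    using lsin_lcos_add(2)[of 2 0 0 0 0 "-2"] lsin_lcos_uminus[of 0 0 2] by simp
  have 2: "lcos 2 0 2 = ?a * ?d - ?b * ?e" "lsin 2 0 2 = ?b * ?d + ?a * ?e"
    using lsin_lcos_add[of 2 0 0 0 0 2] by simp_all
  have 3: "lcos 0 2 0 = lcos 2 2 2 * lcos 2 0 2 + lsin 2 2 2 * lsin 2 0 2"
    using lsin_lcos_add(2)[of 2 "-2" 2 0 2 "-2"] lsin_lcos_uminus[of 2 0 2] by simp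
  \<comment> \<open>A polynomial identity: c, s stand for cosine and sine of x + y + z, likewise a,
    b for those of 2x and d, e for those of 2z.\<close>
  have "2 * (b * (2 * (c * d + s * e) * s - (s * d - c * e) * c) + a * (c * d + s * e) * c) =
      (c ^ 2 - s ^ 2) * (a * d - b * e) + 2 * (s * c) * (b * d + a * e)
      + 2 * (a * d + b * e) - (a * d - b * e)"
    if "c ^ 2 + s ^ 2 = 1" for a b c d e s :: fps3
    using that by algebra
  then show ?thesis
    unfolding S 3 1 2 sin2_cos2_s kl using lcos2_lsin2 by blast
qed

section \<open>Forests with a distinguished right branch\<close>

fun full :: "'a tree \<Rightarrow> bool" where
  "full Leaf = False"
| "full (Node l a r) = (l = Leaf \<and> r = Leaf \<or> full l \<and> full r)"

text \<open>A nonempty such tree ends in a node with a left child only, the exceptional rightmost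
  node of a complete tree of even size. These trees have even size, the \<open>full\<close> ones odd
  size.\<close>

fun spine :: "'a tree \<Rightarrow> bool" where
  "spine Leaf = True"
| "spine (Node l a r) = (full l \<and> spine r)"

text \<open>The tree s continues the rightmost path and may be empty; the trees in xs are
  the other pending subtrees.\<close>

definition forests :: "nat set \<Rightarrow> nat \<Rightarrow> (nat tree \<times> nat tree list) set" where
  "forests A j = {(s, xs). length xs = j \<and> spine s \<and> heap s \<and> (\<forall>x\<in>set xs. full x \<and> heap x) \<and>
     mset_tree s + sum_list (map mset_tree xs) = mset_set A}"

lemma forests_iff:
  "(s, xs) \<in> forests A j \<longleftrightarrow> length xs = j \<and> spine s \<and> heap s \<and> (\<forall>x\<in>set xs. full x \<and> heap x) \<and>
     mset_tree s + sum_list (map mset_tree xs) = mset_set A"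
  by (simp add: forests_def)

lemma set_mset_sum_list: "set_mset (sum_list Ms) = (\<Union>M\<in>set Ms. set_mset M)"
  by (induction Ms) simp_all

lemma forests_labels:
  assumes "(s, xs) \<in> forests A j" "finite A"
  shows "set_tree s \<subseteq> A" "x \<in> set xs \<Longrightarrow> set_tree x \<subseteq> A"
    and "a \<in> A \<Longrightarrow> a \<in> set_tree s \<or> (\<exists>x\<in>set xs. a \<in> set_tree x)"
proof -
  have "set_mset (mset_tree s + sum_list (map mset_tree xs)) = A"
    using assms by (simp add: forests_iff)
  then have "set_tree s \<union> (\<Union>x\<in>set xs. set_tree x) = A"
    by (simp add: set_mset_sum_list)
  then show "set_tree s \<subseteq> A" "x \<in> set xs \<Longrightarrow> set_tree x \<subseteq> A"
    "a \<in> A \<Longrightarrow> a \<in> set_tree s \<or> (\<exists>x\<in>set xs. a \<in> set_tree x)" by auto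
qed

lemma finite_trees: "finite A \<Longrightarrow> finite {t. set_tree t \<subseteq> A \<and> size t \<le> n}"
proof (induction n)
  case 0
  have "{t. set_tree t \<subseteq> A \<and> size t \<le> 0} \<subseteq> {Leaf}" by auto
  then show ?case by (rule finite_subset) simp
next
  case (Suc n)
  let ?T = "{t. set_tree t \<subseteq> A \<and> size t \<le> n}"
  have "{t. set_tree t \<subseteq> A \<and> size t \<le> Suc n} \<subseteq> insert Leaf ((\<lambda>(l, a, r). Node l a r) ` (?T \<times> A \<times> ?T))"
  proof
    fix t assume "t \<in> {t. set_tree t \<subseteq> A \<and> size t \<le> Suc n}"
    then show "t \<in> insert Leaf ((\<lambda>(l, a, r). Node l a r) ` (?T \<times> A \<times> ?T))"
      by (cases t) (auto intro!: image_eqI[where x = "(_, _, _)"])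
  qed
  then show ?case using Suc by (auto intro: finite_subset)
qed

lemma sum_list_size_mset: "size (sum_list Ms) = sum_list (map size Ms)" for Ms :: "'a multiset list"
  by (induction Ms) simp_all

lemma forests_size:
  assumes "(s, xs) \<in> forests A j"
  shows "size s + sum_list (map size xs) = card A"
proof -
  have "size (mset_tree s + sum_list (map mset_tree xs)) = card A"
    using assms by (simp add: forests_iff)
  then show ?thesis by (simp add: sum_list_size_mset comp_def)
qed

lemma finite_forests:
  assumes "finite A"
  shows "finite (forests A j)"
proof -
  let ?T = "{t. set_tree t \<subseteq> A \<and> size t \<le> card A}"
  have "forests A j \<subseteq> ?T \<times> {xs. set xs \<subseteq> ?T \<and> length xs = j}"
  proof (rule subrelI)
    fix s xs assume F: "(s, xs) \<in> forests A j"
    have "size x \<le> sum_list (map size xs)" if "x \<in> set xs" for x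
      using that by (simp add: member_le_sum_list)
    then have "size x \<le> card A" if "x \<in> set xs" for x
      using that forests_size[OF F] by fastforce
    then show "(s, xs) \<in> ?T \<times> {xs. set xs \<subseteq> ?T \<and> length xs = j}"
      using F forests_labels[OF F assms] forests_size[OF F] by (auto simp: forests_iff)
  qed
  moreover have "finite (?T \<times> {xs. set xs \<subseteq> ?T \<and> length xs = j})"
    by (intro finite_cartesian_product finite_lists_length_eq finite_trees assms)
  ultimately show ?thesis by (rule finite_subset)
qed

section \<open>Counting forests and rearranging their lists\<close>

definition cnt :: "nat set \<Rightarrow> nat \<Rightarrow> (nat tree \<Rightarrow> nat tree list \<Rightarrow> bool) \<Rightarrow> nat" where
  "cnt A j P = card {(s, xs). (s, xs) \<in> forests A j \<and> P s xs}"

lemma finite_cnt: "finite A \<Longrightarrow> finite {(s, xs). (s, xs) \<in> forests A j \<and> P s xs}"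
  by (rule finite_subset[OF _ finite_forests[of A j]]) auto

lemma cnt_cong:
  "(\<And>s xs. (s, xs) \<in> forests A j \<Longrightarrow> P s xs \<longleftrightarrow> Q s xs) \<Longrightarrow> cnt A j P = cnt A j Q"
  unfolding cnt_def by (rule arg_cong[where f = card]) auto

lemma cnt_False:
  "(\<And>s xs. (s, xs) \<in> forests A j \<Longrightarrow> \<not> P s xs) \<Longrightarrow> cnt A j P = 0"
  using cnt_cong[of A j P "\<lambda>_ _. False"] by (simp add: cnt_def)

lemma cnt_disj:
  assumes "finite A" "\<And>s xs. (s, xs) \<in> forests A j \<Longrightarrow> \<not> (P s xs \<and> Q s xs)"
  shows "cnt A j (\<lambda>s xs. P s xs \<or> Q s xs) = cnt A j P + cnt A j Q"
proof -
  have "{(s, xs). (s, xs) \<in> forests A j \<and> (P s xs \<or> Q s xs)} =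
      {(s, xs). (s, xs) \<in> forests A j \<and> P s xs} \<union> {(s, xs). (s, xs) \<in> forests A j \<and> Q s xs}"
    by auto
  then show ?thesis
    unfolding cnt_def using assms by (subst card_Un_disjoint[symmetric]) (auto intro: finite_cnt)
qed

lemma sum_list_map_mset_cong:
  "mset xs = mset ys \<Longrightarrow> sum_list (map f xs) = sum_list (map f ys)"
  for f :: "'a \<Rightarrow> 'b::comm_monoid_add"
  by (metis mset_map sum_mset_sum_list)

text \<open>An injective rearrangement maps the finite set of forests into itself, hence permutes
  it. This brings distinguished trees back to the front after a removal has pushed freed subtrees
  before them.\<close>

lemma cnt_reorder:
  assumes A: "finite A" and f: "\<And>xs. length xs = j \<Longrightarrow> mset (f xs) = mset xs"
    and inj: "inj_on f {xs. length xs = j}"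
  shows "cnt A j (\<lambda>s xs. P s (f xs)) = cnt A j P"
proof -
  let ?F = "\<lambda>(s::nat tree, xs). (s, f xs)"
  have mem: "(s, f xs) \<in> forests A j" if "(s, xs) \<in> forests A j" for s xs
  proof -
    have m: "mset (f xs) = mset xs" using f that by (simp add: forests_iff)
    show ?thesis
      using that mset_eq_setD[OF m] mset_eq_length[OF m] sum_list_map_mset_cong[OF m, of mset_tree]
      by (simp add: forests_iff)
  qed
  have i: "inj_on ?F (forests A j)"
    using inj by (auto simp: inj_on_def forests_iff)
  have im: "?F ` forests A j = forests A j"
    by (rule endo_inj_surj[OF finite_forests[OF A] _ i]) (auto intro: mem)
  have surj: "\<exists>ys. (s, ys) \<in> forests A j \<and> xs = f ys" if "(s, xs) \<in> forests A j" for s xs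
  proof -
    have "(s, xs) \<in> ?F ` forests A j" using that im by simp
    then show ?thesis by (rule imageE) (simp split: prod.splits, blast)
  qed
  have "?F ` {(s, xs). (s, xs) \<in> forests A j \<and> P s (f xs)} =
      {(s, xs). (s, xs) \<in> forests A j \<and> P s xs}" (is "?F ` ?L = ?R")
  proof (intro equalityI subsetI)
    fix F assume "F \<in> ?R"
    then obtain s xs where F: "F = (s, xs)" "(s, xs) \<in> forests A j" "P s xs" by blast
    then obtain ys where "(s, ys) \<in> forests A j" "xs = f ys" using surj by blast
    then show "F \<in> ?F ` ?L" using F by (intro image_eqI[of _ _ "(s, ys)"]) auto
  qed (auto intro: mem)
  moreover have "inj_on ?F {(s, xs). (s, xs) \<in> forests A j \<and> P s (f xs)}"
    by (rule inj_on_subset[OF i]) auto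
  ultimately show ?thesis
    unfolding cnt_def using card_image[of ?F "{(s, xs). (s, xs) \<in> forests A j \<and> P s (f xs)}"]
    by simp
qed

section \<open>Removing the smallest label\<close>

text \<open>This and the next two definitions invert the removal of the smallest label i. Whatever
  the place p of the removed root, its subtrees are taken from the front of the list; the j choices
  of p yield the factors j of the recursions.\<close>

definition at_spine :: "nat \<Rightarrow> nat tree \<times> nat tree list \<Rightarrow> nat tree \<times> nat tree list" where
  "at_spine i = (\<lambda>(s, ys). (Node (hd ys) i s, tl ys))"

definition ins_leaf :: "nat \<Rightarrow> nat \<Rightarrow> nat tree list \<Rightarrow> nat tree list" where
  "ins_leaf i p ys = take p ys @ Node Leaf i Leaf # drop p ys"

definition ins_node :: "nat \<Rightarrow> nat \<Rightarrow> nat tree list \<Rightarrow> nat tree list" where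
  "ins_node i p ys = take p (drop 2 ys) @ Node (hd ys) i (ys ! 1) # drop p (drop 2 ys)"

text \<open>Used with Q saying that a tree contains the fresh label i: the unique such tree
  determines where i was inserted, so the insertions are injective and have disjoint images.\<close>

lemma split_marked_unique:
  assumes "us @ t # vs = us' @ t' # vs'" "Q t" "Q t'" "\<forall>x\<in>set us \<union> set us'. \<not> Q x"
  shows "us = us' \<and> t = t' \<and> vs = vs'"
proof -
  have "us = takeWhile (\<lambda>x. \<not> Q x) (us @ t # vs)" "us' = takeWhile (\<lambda>x. \<not> Q x) (us' @ t' # vs')"
    using assms(2-4) by (subst takeWhile_append2; auto)+
  then have "us = us'" by (simp only: assms(1))
  then show ?thesis using assms(1) by simp
qed

lemma take_drop_unique:
  assumes "take p ys = take q zs" "drop p ys = drop q zs" "p \<le> length ys" "q \<le> length zs"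
  shows "p = q \<and> ys = zs"
  using assms by (metis append_take_drop_id length_take min.absorb2)

lemma forests_two:
  assumes "(s, ys) \<in> forests A (Suc j)" "p < j"
  obtains l r zs where "ys = l # r # zs"
  \<comment> \<open>The rule serves only for its split into empty, singleton and longer
    lists.\<close>
  using assms by (cases ys rule: remdups_adj.cases) (auto simp: forests_iff)

context
  fixes i :: nat and A :: "nat set"
  assumes fin: "finite A" and less: "\<And>a. a \<in> A \<Longrightarrow> i < a"
begin

lemma fresh:
  assumes "(s, xs) \<in> forests A j"
  shows "i \<notin> set_tree s" "x \<in> set xs \<Longrightarrow> i \<notin> set_tree x"
  using forests_labels[OF assms fin] less by blast+

lemma mset_set_insert: "mset_set (insert i A) = add_mset i (mset_set A)"
  using fin less by (subst mset_set.insert) auto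

lemma above:
  assumes "(s, xs) \<in> forests A j"
  shows "a \<in> set_tree s \<Longrightarrow> i \<le> a" "x \<in> set xs \<Longrightarrow> a \<in> set_tree x \<Longrightarrow> i \<le> a"
  using forests_labels[OF assms fin] less by (meson less_imp_le subsetD)+

lemma at_spine_in:
  assumes "(s, ys) \<in> forests A (Suc j)"
  shows "at_spine i (s, ys) \<in> forests (insert i A) j"
proof -
  obtain l zs where ys: "ys = l # zs" using assms by (cases ys) (auto simp: forests_iff)
  show ?thesis using assms above[OF assms]
    by (auto simp: ys at_spine_def forests_iff mset_set_insert add_ac)
qed

lemma ins_leaf_in:
  assumes "(s, ys) \<in> forests A (j - 1)" "p < j"
  shows "(s, ins_leaf i p ys) \<in> forests (insert i A) j"
proof -
  have "p \<le> length ys" using assms by (auto simp: forests_iff)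
  then obtain us vs where "ys = us @ vs" "length us = p"
    by (metis append_take_drop_id length_take min.absorb2)
  then show ?thesis using assms by (auto simp: ins_leaf_def forests_iff mset_set_insert)
qed

lemma ins_node_in:
  assumes "(s, ys) \<in> forests A (Suc j)" "p < j"
  shows "(s, ins_node i p ys) \<in> forests (insert i A) j"
proof -
  obtain l r zs where ys: "ys = l # r # zs"
    using forests_two[OF assms] .
  have "p \<le> length zs" using assms by (auto simp: forests_iff ys)
  then obtain us vs where "zs = us @ vs" "length us = p"
    by (metis append_take_drop_id length_take min.absorb2)
  then show ?thesis using assms above[OF assms(1)]
    by (auto simp: ys ins_node_def forests_iff mset_set_insert add_ac)
qed

lemma root_least:
  assumes "i \<in> set_tree t" "heap t" "set_tree t \<subseteq> insert i A"
  obtains l r where "t = Node l i r"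
proof (cases t)
  case (Node l a r)
  then have "a \<le> i" "a \<in> insert i A" using assms by auto
  then have "a = i" using less by fastforce
  then show ?thesis using Node that by blast
qed (use assms in simp)

text \<open>By heap order the least label i is the root of its tree. That tree is the spine, a
  single leaf, or a tree whose two subtrees are both full.\<close>

lemma forests_cases:
  assumes F: "(s, xs) \<in> forests (insert i A) j"
  obtains (spine) ys where "(s, xs) = at_spine i ys" "ys \<in> forests A (Suc j)"
    | (leaf) p ys where "p < j" "xs = ins_leaf i p ys" "(s, ys) \<in> forests A (j - 1)"
    | (node) p ys where "p < j" "xs = ins_node i p ys" "(s, ys) \<in> forests A (Suc j)"
proof -
  have fin': "finite (insert i A)" using fin by simp
  note lab = forests_labels[OF F fin']
  from lab(3)[of i] consider "i \<in> set_tree s" | x where "x \<in> set xs" "i \<in> set_tree x" by blast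
  then show thesis
  proof cases
    case 1
    then obtain l r where s: "s = Node l i r"
      using root_least[of s] lab(1) F by (auto simp: forests_iff)
    have "(r, l # xs) \<in> forests A (Suc j)"
      using F by (auto simp: s forests_iff mset_set_insert add_ac)
    then show thesis using spine[of "(r, l # xs)"] by (simp add: at_spine_def s)
  next
    case 2
    then obtain l r where x: "x = Node l i r"
      using root_least[of x] lab(2) F by (auto simp: forests_iff)
    obtain us vs where xs: "xs = us @ x # vs" using 2 by (meson split_list)
    have p: "length us < j" using F by (auto simp: forests_iff xs)
    show thesis
    proof (cases "l = Leaf \<and> r = Leaf")
      case True
      have "(s, us @ vs) \<in> forests A (j - 1)"
        using F True by (auto simp: xs x forests_iff mset_set_insert)
      then show thesis using leaf[OF p, of "us @ vs"] True by (simp add: ins_leaf_def xs x)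
    next
      case False
      have "(s, l # r # us @ vs) \<in> forests A (Suc j)"
        using F False by (auto simp: xs x forests_iff mset_set_insert add_ac)
      then show thesis using node[OF p, of "l # r # us @ vs"] by (simp add: ins_node_def xs x)
    qed
  qed
qed

text \<open>The common source of all recursions: for a given statistic it remains to see how P reads
  a forest into which i has been put back. At j = 0 both sums are empty, so the truncated j - 1 does
  not matter.\<close>

lemma cnt_insert:
  "cnt (insert i A) j P =
     cnt A (Suc j) (\<lambda>s ys. P (Node (hd ys) i s) (tl ys))
     + (\<Sum>p<j. cnt A (j - 1) (\<lambda>s ys. P s (ins_leaf i p ys)))
     + (\<Sum>p<j. cnt A (Suc j) (\<lambda>s ys. P s (ins_node i p ys)))"
proof -
  define Z where "Z = {(s, xs). (s, xs) \<in> forests (insert i A) j \<and> P s xs}"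
  define D0 where "D0 = {(s, ys). (s, ys) \<in> forests A (Suc j) \<and> P (Node (hd ys) i s) (tl ys)}"
  define D1 where "D1 p = {(s, ys). (s, ys) \<in> forests A (j - 1) \<and> P s (ins_leaf i p ys)}" for p
  define D2 where "D2 p = {(s, ys). (s, ys) \<in> forests A (Suc j) \<and> P s (ins_node i p ys)}" for p
  let ?f1 = "\<lambda>p (s::nat tree, ys). (s, ins_leaf i p ys)"
  let ?f2 = "\<lambda>p (s::nat tree, ys). (s, ins_node i p ys)"
  have finD: "finite D0" "finite (D1 p)" "finite (D2 p)" for p
    unfolding D0_def D1_def D2_def by (intro finite_cnt fin)+
  have Z: "Z = at_spine i ` D0 \<union> ((\<Union>p<j. ?f1 p ` D1 p) \<union> (\<Union>p<j. ?f2 p ` D2 p))"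
  proof (intro equalityI subsetI)
    fix F assume "F \<in> Z"
    then obtain s xs where F: "F = (s, xs)" "(s, xs) \<in> forests (insert i A) j" "P s xs"
      by (auto simp: Z_def)
    from F(2) show "F \<in> at_spine i ` D0 \<union> ((\<Union>p<j. ?f1 p ` D1 p) \<union> (\<Union>p<j. ?f2 p ` D2 p))"
    proof (cases rule: forests_cases)
      case (spine ys)
      then have "ys \<in> D0" using F by (auto simp: D0_def at_spine_def)
      then show ?thesis using spine F by auto
    next
      case (leaf p ys)
      then have "(s, ys) \<in> D1 p" using F by (auto simp: D1_def)
      then show ?thesis using leaf F by force
    next
      case (node p ys)
      then have "(s, ys) \<in> D2 p" using F by (auto simp: D2_def)
      then show ?thesis using node F by force
    qed
  next
    fix F assume "F \<in> at_spine i ` D0 \<union> ((\<Union>p<j. ?f1 p ` D1 p) \<union> (\<Union>p<j. ?f2 p ` D2 p))"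
    then show "F \<in> Z"
      using at_spine_in ins_leaf_in ins_node_in
      by (auto simp: D0_def D1_def D2_def Z_def at_spine_def)
  qed
  have inj0: "inj_on (at_spine i) D0"
    by (rule inj_onI) (auto simp: D0_def at_spine_def forests_iff, metis hd_Cons_tl list.size(3) nat.distinct(1))
  have eq1: "p = p' \<and> ys = ys'"
    if "ins_leaf i p ys = ins_leaf i p' ys'" "(s, ys) \<in> forests A (j - 1)" "(s', ys') \<in> forests A (j - 1)"
      "p < j" "p' < j" for p p' ys ys' s s'
  proof -
    have "take p ys = take p' ys' \<and> Node Leaf i Leaf = Node Leaf i Leaf \<and> drop p ys = drop p' ys'"
      using that fresh(2)[OF that(2)] fresh(2)[OF that(3)]
      by (intro split_marked_unique[where Q = "\<lambda>t. i \<in> set_tree t"])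
        (auto simp: ins_leaf_def dest: in_set_takeD)
    moreover have "length ys = j - 1" "length ys' = j - 1" using that by (auto simp: forests_iff)
    ultimately show ?thesis using take_drop_unique[of p ys p' ys'] that(4,5) by simp
  qed
  have eq2: "p = p' \<and> ys = ys'"
    if h: "ins_node i p ys = ins_node i p' ys'" "(s, ys) \<in> forests A (Suc j)" "(s', ys') \<in> forests A (Suc j)"
      "p < j" "p' < j" for p p' ys ys' s s'
  proof -
    obtain l r zs where ys: "ys = l # r # zs"
      using forests_two[OF h(2,4)] .
    obtain l' r' zs' where ys': "ys' = l' # r' # zs'"
      using forests_two[OF h(3,5)] .
    have "take p zs = take p' zs' \<and> Node l i r = Node l' i r' \<and> drop p zs = drop p' zs'"
      using h fresh(2)[OF h(2)] fresh(2)[OF h(3)]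
      by (intro split_marked_unique[where Q = "\<lambda>t. i \<in> set_tree t"])
        (auto simp: ins_node_def ys ys' dest: in_set_takeD)
    moreover have "length zs = j - 1" "length zs' = j - 1" using h by (auto simp: forests_iff ys ys')
    ultimately show ?thesis
      using take_drop_unique[of p zs p' zs'] h(4,5) by (simp add: ys ys')
  qed
  have neq: "ins_leaf i p ys \<noteq> ins_node i p' ys'"
    if h: "(s, ys) \<in> forests A (j - 1)" "(s', ys') \<in> forests A (Suc j)" "p < j" "p' < j"
    for p p' ys ys' s s'
  proof
    assume eq: "ins_leaf i p ys = ins_node i p' ys'"
    obtain l r zs where ys': "ys' = l # r # zs"
      using forests_two[OF h(2,4)] .
    have "take p ys = take p' zs \<and> Node Leaf i Leaf = Node l i r \<and> drop p ys = drop p' zs"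
      using h eq fresh(2)[OF h(1)] fresh(2)[OF h(2)]
      by (intro split_marked_unique[where Q = "\<lambda>t. i \<in> set_tree t"])
        (auto simp: ins_leaf_def ins_node_def ys' dest: in_set_takeD)
    \<comment> \<open>The subtrees of an inner node come from the list and are therefore full, hence
      nonempty, unlike those of a leaf.\<close>
    then show False using h by (auto simp: ys' forests_iff)
  qed
  have inj1: "inj_on (?f1 p) (D1 p)" and inj2: "inj_on (?f2 p) (D2 p)" if "p < j" for p
    using that by - (rule inj_onI; clarsimp simp: D1_def D2_def simp del: One_nat_def; blast dest: eq1 eq2)+
  have d1: "at_spine i ` D0 \<inter> ((\<Union>p<j. ?f1 p ` D1 p) \<union> (\<Union>p<j. ?f2 p ` D2 p)) = {}"
    by (auto simp: D0_def D1_def D2_def at_spine_def dest: fresh(1))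
  have d2: "(\<Union>p<j. ?f1 p ` D1 p) \<inter> (\<Union>p<j. ?f2 p ` D2 p) = {}"
    using neq by (auto simp: D1_def D2_def)
  have c1: "card (\<Union>p<j. ?f1 p ` D1 p) = (\<Sum>p<j. card (?f1 p ` D1 p))"
  proof (rule card_UN_disjoint)
    show "\<forall>p\<in>{..<j}. \<forall>q\<in>{..<j}. p \<noteq> q \<longrightarrow> ?f1 p ` D1 p \<inter> ?f1 q ` D1 q = {}"
      by (auto simp: D1_def dest: eq1)
  qed (use finD in auto)
  have c2: "card (\<Union>p<j. ?f2 p ` D2 p) = (\<Sum>p<j. card (?f2 p ` D2 p))"
  proof (rule card_UN_disjoint)
    show "\<forall>p\<in>{..<j}. \<forall>q\<in>{..<j}. p \<noteq> q \<longrightarrow> ?f2 p ` D2 p \<inter> ?f2 q ` D2 q = {}"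
      by (auto simp: D2_def dest: eq2)
  qed (use finD in auto)
  have "card Z = card D0 + ((\<Sum>p<j. card (?f1 p ` D1 p)) + (\<Sum>p<j. card (?f2 p ` D2 p)))"
    unfolding Z using finD by (simp add: card_Un_disjoint d1 d2 card_image[OF inj0] c1 c2)
  also have "\<dots> = card D0 + ((\<Sum>p<j. card (D1 p)) + (\<Sum>p<j. card (D2 p)))"
    using inj1 inj2 by (simp add: card_image)
  finally show ?thesis
    unfolding cnt_def Z_def D0_def D1_def D2_def by simp
qed

end

section \<open>Recursions for the statistics\<close>

text \<open>The relation inside \<open>pom\<close>, with the largest label M as a parameter instead
  of the size of the tree. In this form it survives the passage to the components of a
  forest.\<close>

fun parent_of :: "nat \<Rightarrow> nat \<Rightarrow> nat tree \<Rightarrow> bool" where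
  "parent_of M k Leaf = False"
| "parent_of M k (Node l a r) =
     (a = k \<and> M \<in> child_labels l r \<or> parent_of M k l \<or> parent_of M k r)"

definition pom_forest :: "nat \<Rightarrow> nat \<Rightarrow> nat tree \<Rightarrow> nat tree list \<Rightarrow> bool" where
  "pom_forest M k s xs \<longleftrightarrow> parent_of M k s \<or> (\<exists>x\<in>set xs. parent_of M k x)"

text \<open>As long as the minimal chain follows the rightmost path, its next node is the root of the
  spine or of the first tree of the list; afterwards it is the root of one of the first two trees
  of the list. The two predicates \<open>eoc_pom_spine\<close> and \<open>eoc_pom_inner\<close> describe
  these two states.\<close>

definition eoc_pair :: "nat tree \<Rightarrow> nat tree \<Rightarrow> nat" where
  "eoc_pair l r = (if Min (child_labels l r) \<in> root_labels l then eoc l else eoc r)"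

definition eoc_pom_spine :: "nat \<Rightarrow> nat \<Rightarrow> nat \<Rightarrow> nat tree \<Rightarrow> nat tree list \<Rightarrow> bool" where
  "eoc_pom_spine m M k s xs \<longleftrightarrow> eoc_pair (hd xs) s = m \<and> pom_forest M k s xs"

definition eoc_pom_inner :: "nat \<Rightarrow> nat \<Rightarrow> nat \<Rightarrow> nat tree \<Rightarrow> nat tree list \<Rightarrow> bool" where
  "eoc_pom_inner m M k s xs \<longleftrightarrow> eoc_pair (hd xs) (xs ! 1) = m \<and> pom_forest M k s xs"

lemma parent_of_label: "parent_of M k t \<Longrightarrow> k \<in> set_tree t"
  by (induction t) auto

lemma root_labels_subset: "root_labels t \<subseteq> set_tree t"
  by (cases t) auto

lemma root_labels_empty_iff: "root_labels t = {} \<longleftrightarrow> t = Leaf"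
  by (cases t) auto

lemma root_labels_not_Leaf: "a \<in> root_labels t \<Longrightarrow> t \<noteq> Leaf"
  by auto

lemma finite_root_labels: "finite (root_labels t)"
  by (cases t) auto

lemma finite_child_labels: "finite (child_labels l r)"
  by (simp add: child_labels_def finite_root_labels)

lemma full_not_Leaf: "full t \<Longrightarrow> t \<noteq> Leaf"
  by auto

lemma Min_child_labels_in: "l \<noteq> Leaf \<or> r \<noteq> Leaf \<Longrightarrow> Min (child_labels l r) \<in> root_labels l \<union> root_labels r"
  using Min_in[OF finite_child_labels[of l r]]
  by (auto simp: child_labels_def root_labels_empty_iff)

lemma eoc_Node: "l \<noteq> Leaf \<or> r \<noteq> Leaf \<Longrightarrow> eoc (Node l a r) = eoc_pair l r"
  by (auto simp: eoc_pair_def)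

lemma eoc_in: "t \<noteq> Leaf \<Longrightarrow> eoc t \<in> set_tree t"
proof (induction t)
  case (Node l a r)
  show ?case
  proof (cases "l = Leaf \<and> r = Leaf")
    case False
    then have "Min (child_labels l r) \<in> root_labels l \<union> root_labels r"
      by (intro Min_child_labels_in) auto
    then show ?thesis using Node False
      by (auto dest: root_labels_not_Leaf)
  qed simp
qed simp

lemma eoc_pair_in: "l \<noteq> Leaf \<Longrightarrow> eoc_pair l r \<in> set_tree l \<union> set_tree r"
  using Min_child_labels_in[of l r] eoc_in[of l] eoc_in[of r]
  by (auto simp: eoc_pair_def dest: root_labels_not_Leaf)

text \<open>Only the case i' = i has content: then i is the smaller root label and the chain enters
  the left tree.\<close>

lemma eoc_pair_least_left:
  assumes "\<And>a. a \<in> root_labels r \<Longrightarrow> i < a"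
  shows "eoc_pair (Node l i' r') r = (if i' = i then eoc (Node l i r') else eoc_pair (Node l i' r') r)"
proof -
  have "Min (child_labels (Node l i r') r) = i"
    using assms by (intro Min_eqI) (auto simp: child_labels_def finite_root_labels less_imp_le)
  then show ?thesis by (auto simp: eoc_pair_def)
qed

lemma eoc_pair_least_right:
  assumes "\<And>a. a \<in> root_labels l \<Longrightarrow> i < a"
  shows "eoc_pair l (Node l' i r') = eoc (Node l' i r')"
proof -
  have "Min (child_labels l (Node l' i r')) = i"
    using assms by (intro Min_eqI) (auto simp: child_labels_def finite_root_labels less_imp_le)
  then show ?thesis using assms by (auto simp: eoc_pair_def)
qed

lemma pom_forest_ins_leaf:
  assumes "i \<noteq> k"
  shows "pom_forest M k s (ins_leaf i p ys) \<longleftrightarrow> pom_forest M k s ys"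
proof -
  have "set ys = set (take p ys) \<union> set (drop p ys)"
    by (metis append_take_drop_id set_append)
  then show ?thesis using assms by (auto simp: pom_forest_def ins_leaf_def)
qed

lemma pom_forest_ins_node:
  assumes "i \<noteq> k"
  shows "pom_forest M k s (ins_node i p (l # r # zs)) \<longleftrightarrow> pom_forest M k s (l # r # zs)"
proof -
  have "set zs = set (take p zs) \<union> set (drop p zs)"
    by (metis append_take_drop_id set_append)
  then show ?thesis using assms by (auto simp: pom_forest_def ins_node_def)
qed

lemma pom_forest_at_spine:
  "i \<noteq> k \<Longrightarrow> pom_forest M k (Node l i s) ys \<longleftrightarrow> pom_forest M k s (l # ys)"
  by (auto simp: pom_forest_def)

lemma pom_forest_reorder: "set xs = set ys \<Longrightarrow> pom_forest M k s xs \<longleftrightarrow> pom_forest M k s ys"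
  by (simp add: pom_forest_def)

lemma cnt_empty: "cnt {} j (\<lambda>_ _. True) = (if j = 0 then 1 else 0)"
proof -
  have "(s, xs) \<in> forests {} j \<longleftrightarrow> j = 0 \<and> s = Leaf \<and> xs = []" for s xs
    by (cases xs) (auto simp: forests_iff)
  then have "{(s, xs). (s, xs) \<in> forests {} j \<and> True} = (if j = 0 then {(Leaf, [])} else {})"
    by auto
  then show ?thesis by (simp add: cnt_def)
qed

section \<open>Effect of removing a smallest label other than k\<close>

context
  fixes i :: nat and A :: "nat set"
  assumes fin: "finite A" and less: "\<And>a. a \<in> A \<Longrightarrow> i < a"
begin

lemmas insert_rule = cnt_insert[OF fin less]

lemma cnt_True_insert:
  "cnt (insert i A) j (\<lambda>_ _. True) =
     j * cnt A (j - 1) (\<lambda>_ _. True) + (j + 1) * cnt A (j + 1) (\<lambda>_ _. True)"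
  by (simp add: insert_rule)

lemma cnt_pom_insert:
  assumes "i \<noteq> k"
  shows "cnt (insert i A) j (pom_forest M k) =
    j * cnt A (j - 1) (pom_forest M k) + (j + 1) * cnt A (j + 1) (pom_forest M k)"
proof -
  have 1: "cnt A (Suc j) (\<lambda>s ys. pom_forest M k (Node (hd ys) i s) (tl ys)) = cnt A (Suc j) (pom_forest M k)"
  proof (rule cnt_cong)
    fix s ys assume "(s, ys) \<in> forests A (Suc j)"
    then have "hd ys # tl ys = ys" by (cases ys) (auto simp: forests_iff)
    then show "pom_forest M k (Node (hd ys) i s) (tl ys) = pom_forest M k s ys"
      by (simp add: pom_forest_at_spine[OF assms])
  qed
  have 2: "cnt A (Suc j) (\<lambda>s ys. pom_forest M k s (ins_node i p ys)) = cnt A (Suc j) (pom_forest M k)"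
    if "p < j" for p
  proof (rule cnt_cong)
    fix s ys assume "(s, ys) \<in> forests A (Suc j)"
    then obtain l r zs where "ys = l # r # zs" using forests_two[OF _ \<open>p < j\<close>] by blast
    then show "pom_forest M k s (ins_node i p ys) = pom_forest M k s ys"
      by (simp add: pom_forest_ins_node[OF assms])
  qed
  show ?thesis
    by (simp add: insert_rule 1 2 pom_forest_ins_leaf[OF assms])
qed

lemma roots_above:
  assumes "(s, ys) \<in> forests A j"
  shows "a \<in> root_labels s \<Longrightarrow> i < a" "x \<in> set ys \<Longrightarrow> a \<in> root_labels x \<Longrightarrow> i < a"
  using forests_labels(1,2)[OF assms fin] less root_labels_subset[of s] root_labels_subset[of x]
  by (meson subsetD)+

lemma ins_leaf_Suc: "ins_leaf i (Suc p) (a # ys) = a # ins_leaf i p ys"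
  by (simp add: ins_leaf_def)

lemma ins_node_0: "ins_node i 0 (l # r # zs) = Node l i r # zs"
  by (simp add: ins_node_def)

lemma ins_node_Suc: "ins_node i (Suc p) (l # r # a # zs) = a # ins_node i p (l # r # zs)"
  by (simp add: ins_node_def)

lemma ins_leaf_0: "ins_leaf i 0 ys = Node Leaf i Leaf # ys"
  by (simp add: ins_leaf_def)

text \<open>The first tree is distinguished, as sibling of the spine. If i is the spine root, the
  chain advances along the right path and the freed left subtree becomes the new sibling. If i is
  the root of the first tree, the chain either ends there (leaf, so i = m) or passes to the inner
  state. Otherwise i lies at the root of one of the j other trees and the chain is unaffected. The
  factor j + 1 joins the spine root with these j trees.\<close>

lemma cnt_spine_insert:
  assumes ik: "i \<noteq> k"
  shows "cnt (insert i A) (j + 1) (eoc_pom_spine m M k) =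
    j * cnt A j (eoc_pom_spine m M k) + (j + 1) * cnt A (j + 2) (eoc_pom_spine m M k)
    + cnt A (j + 2) (eoc_pom_inner m M k)
    + (if i = m then cnt A j (pom_forest M k) else 0)"
proof -
  have 1: "cnt A (Suc (Suc j)) (\<lambda>s ys. eoc_pom_spine m M k (Node (hd ys) i s) (tl ys)) =
      cnt A (Suc (Suc j)) (eoc_pom_spine m M k)"
  proof (rule cnt_cong)
    fix s ys assume F: "(s, ys) \<in> forests A (Suc (Suc j))"
    obtain l a zs where ys: "ys = l # a # zs" using forests_two[OF F] by blast
    have "eoc_pair a (Node l i s) = eoc_pair l s"
      using F roots_above(2)[OF F, of a] full_not_Leaf[of l]
      by (subst eoc_pair_least_right) (auto simp: ys eoc_Node forests_iff simp del: eoc.simps(2))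
    then show "eoc_pom_spine m M k (Node (hd ys) i s) (tl ys) = eoc_pom_spine m M k s ys"
      by (simp add: eoc_pom_spine_def ys pom_forest_at_spine[OF ik])
  qed
  have 2: "cnt A j (\<lambda>s ys. eoc_pom_spine m M k s (ins_leaf i 0 ys)) =
      (if i = m then cnt A j (pom_forest M k) else 0)"
  proof -
    have "eoc_pom_spine m M k s (ins_leaf i 0 ys) \<longleftrightarrow> i = m \<and> pom_forest M k s ys"
      if F: "(s, ys) \<in> forests A j" for s ys
      using roots_above(1)[OF F] pom_forest_ins_leaf[OF ik]
      by (subst eoc_pom_spine_def, subst ins_leaf_0, unfold list.sel, subst eoc_pair_least_left) auto
    then have "cnt A j (\<lambda>s ys. eoc_pom_spine m M k s (ins_leaf i 0 ys)) =
        cnt A j (\<lambda>s ys. i = m \<and> pom_forest M k s ys)" by (rule cnt_cong)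
    then show ?thesis by (simp add: cnt_False)
  qed
  have 3: "cnt A j (\<lambda>s ys. eoc_pom_spine m M k s (ins_leaf i (Suc p) ys)) =
      cnt A j (eoc_pom_spine m M k)" if "p < j" for p
  proof (rule cnt_cong)
    fix s ys assume F: "(s, ys) \<in> forests A j"
    then obtain a zs where ys: "ys = a # zs" using \<open>p < j\<close> by (cases ys) (auto simp: forests_iff)
    show "eoc_pom_spine m M k s (ins_leaf i (Suc p) ys) = eoc_pom_spine m M k s ys"
      using pom_forest_ins_leaf[OF ik, of M s "Suc p" ys]
      by (simp add: eoc_pom_spine_def ys ins_leaf_Suc)
  qed
  have 4: "cnt A (Suc (Suc j)) (\<lambda>s ys. eoc_pom_spine m M k s (ins_node i 0 ys)) =
      cnt A (Suc (Suc j)) (eoc_pom_inner m M k)"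
  proof (rule cnt_cong)
    fix s ys assume F: "(s, ys) \<in> forests A (Suc (Suc j))"
    obtain l r zs where ys: "ys = l # r # zs" using forests_two[OF F] by blast
    have "eoc_pair (Node l i r) s = eoc_pair l r"
      using F roots_above(1)[OF F] full_not_Leaf[of l]
      by (subst eoc_pair_least_left[of _ i]) (auto simp: ys eoc_Node forests_iff simp del: eoc.simps(2))
    then show "eoc_pom_spine m M k s (ins_node i 0 ys) = eoc_pom_inner m M k s ys"
      using pom_forest_ins_node[OF ik, of M s 0 l r zs]
      by (simp add: eoc_pom_spine_def eoc_pom_inner_def ys ins_node_0)
  qed
  have 5: "cnt A (Suc (Suc j)) (\<lambda>s ys. eoc_pom_spine m M k s (ins_node i (Suc p) ys)) =
      cnt A (Suc (Suc j)) (eoc_pom_spine m M k)" if "p < j" for p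
  proof -
    \<comment> \<open>The two freed subtrees stand before the distinguished tree; \<open>?f\<close>
      moves the latter back to the front.\<close>
    let ?f = "\<lambda>ys. (ys ! 2) # (ys ! 0) # (ys ! 1) # drop 3 ys :: nat tree list"
    have len: "\<exists>l r a zs. ys = l # r # a # zs" if "length ys = Suc (Suc j)" for ys :: "nat tree list"
    proof -
      have "length ys = Suc (Suc (Suc (j - 1)))" using that \<open>p < j\<close> by simp
      then show ?thesis by (metis length_Suc_conv)
    qed
    have "cnt A (Suc (Suc j)) (\<lambda>s ys. eoc_pom_spine m M k s (ins_node i (Suc p) ys)) =
        cnt A (Suc (Suc j)) (\<lambda>s ys. eoc_pom_spine m M k s (?f ys))"
    proof (rule cnt_cong)
      fix s ys assume F: "(s, ys) \<in> forests A (Suc (Suc j))"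
      then obtain l r a zs where ys: "ys = l # r # a # zs" using len[of ys] unfolding forests_iff by blast
      have "pom_forest M k s (?f ys) = pom_forest M k s ys"
        by (rule pom_forest_reorder) (auto simp: ys)
      then show "eoc_pom_spine m M k s (ins_node i (Suc p) ys) = eoc_pom_spine m M k s (?f ys)"
        using pom_forest_ins_node[OF ik, of M s "Suc p" l r "a # zs"]
        by (simp add: eoc_pom_spine_def ys ins_node_Suc)
    qed
    also have "\<dots> = cnt A (Suc (Suc j)) (eoc_pom_spine m M k)"
    proof (rule cnt_reorder[OF fin])
      show "inj_on ?f {xs. length xs = Suc (Suc j)}"
        by (rule inj_onI) (auto dest!: len)
      show "mset (?f xs) = mset xs" if "length xs = Suc (Suc j)" for xs
        using len[OF that] by auto
    qed
    finally show ?thesis .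
  qed
  show ?thesis
    by (simp add: insert_rule 1 sum.lessThan_Suc_shift 2 3 4 5 del: sum.lessThan_Suc)
qed

text \<open>Now the first two trees are the candidates for the next chain node. The factor j + 3
  consists of the spine root, the two candidates as inner nodes (their subtrees form the next pair)
  and the j other trees. Either candidate may be the leaf m, whence the 2.\<close>

lemma cnt_inner_insert:
  assumes ik: "i \<noteq> k"
  shows "cnt (insert i A) (j + 2) (eoc_pom_inner m M k) =
    j * cnt A (j + 1) (eoc_pom_inner m M k) + (j + 3) * cnt A (j + 3) (eoc_pom_inner m M k)
    + (if i = m then 2 * cnt A (j + 1) (pom_forest M k) else 0)"
proof -
  have len: "\<exists>l r a zs. ys = l # r # a # zs" if "length ys = Suc (Suc (Suc n))" for ys :: "nat tree list" and n
    using that by (metis length_Suc_conv)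
  have 1: "cnt A (Suc (Suc (Suc j))) (\<lambda>s ys. eoc_pom_inner m M k (Node (hd ys) i s) (tl ys)) =
      cnt A (Suc (Suc (Suc j))) (eoc_pom_inner m M k)"
  proof -
    \<comment> \<open>Removing the spine root puts its left subtree before the distinguished pair;
      \<open>?f\<close> moves it behind.\<close>
    let ?f = "\<lambda>ys. (ys ! 1) # (ys ! 2) # (ys ! 0) # drop 3 ys :: nat tree list"
    have "cnt A (Suc (Suc (Suc j))) (\<lambda>s ys. eoc_pom_inner m M k (Node (hd ys) i s) (tl ys)) =
        cnt A (Suc (Suc (Suc j))) (\<lambda>s ys. eoc_pom_inner m M k s (?f ys))"
    proof (rule cnt_cong)
      fix s ys assume F: "(s, ys) \<in> forests A (Suc (Suc (Suc j)))"
      then obtain l r a zs where ys: "ys = l # r # a # zs" using len[of ys] unfolding forests_iff by blast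
      have "pom_forest M k s (?f ys) = pom_forest M k s ys"
        by (rule pom_forest_reorder) (auto simp: ys)
      then show "eoc_pom_inner m M k (Node (hd ys) i s) (tl ys) = eoc_pom_inner m M k s (?f ys)"
        by (simp add: eoc_pom_inner_def ys pom_forest_at_spine[OF ik])
    qed
    also have "\<dots> = cnt A (Suc (Suc (Suc j))) (eoc_pom_inner m M k)"
    proof (rule cnt_reorder[OF fin])
      show "inj_on ?f {xs. length xs = Suc (Suc (Suc j))}"
        by (rule inj_onI) (auto dest!: len)
      show "mset (?f xs) = mset xs" if "length xs = Suc (Suc (Suc j))" for xs
        using len[OF that] by auto
    qed
    finally show ?thesis .
  qed
  have 20: "cnt A (Suc j) (\<lambda>s ys. eoc_pom_inner m M k s (ins_leaf i 0 ys)) =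
      (if i = m then cnt A (Suc j) (pom_forest M k) else 0)"
  proof -
    have "eoc_pom_inner m M k s (ins_leaf i 0 ys) \<longleftrightarrow> i = m \<and> pom_forest M k s ys"
      if F: "(s, ys) \<in> forests A (Suc j)" for s ys
    proof -
      obtain b zs where ys: "ys = b # zs" using F by (cases ys) (auto simp: forests_iff)
      have "eoc_pair (Node Leaf i Leaf) b = i"
        using roots_above(2)[OF F, of b] by (subst eoc_pair_least_left) (auto simp: ys)
      then show ?thesis using pom_forest_ins_leaf[OF ik, of M s 0 ys]
        by (simp add: eoc_pom_inner_def ins_leaf_0 ys)
    qed
    then have "cnt A (Suc j) (\<lambda>s ys. eoc_pom_inner m M k s (ins_leaf i 0 ys)) =
        cnt A (Suc j) (\<lambda>s ys. i = m \<and> pom_forest M k s ys)" by (rule cnt_cong)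
    then show ?thesis by (simp add: cnt_False)
  qed
  have 21: "cnt A (Suc j) (\<lambda>s ys. eoc_pom_inner m M k s (ins_leaf i (Suc 0) ys)) =
      (if i = m then cnt A (Suc j) (pom_forest M k) else 0)"
  proof -
    have "eoc_pom_inner m M k s (ins_leaf i (Suc 0) ys) \<longleftrightarrow> i = m \<and> pom_forest M k s ys"
      if F: "(s, ys) \<in> forests A (Suc j)" for s ys
    proof -
      obtain b zs where ys: "ys = b # zs" using F by (cases ys) (auto simp: forests_iff)
      have "eoc_pair b (Node Leaf i Leaf) = i"
        using roots_above(2)[OF F, of b] by (subst eoc_pair_least_right) (auto simp: ys)
      then show ?thesis using pom_forest_ins_leaf[OF ik, of M s "Suc 0" ys]
        by (simp add: eoc_pom_inner_def ins_leaf_Suc ins_leaf_0 ys)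
    qed
    then have "cnt A (Suc j) (\<lambda>s ys. eoc_pom_inner m M k s (ins_leaf i (Suc 0) ys)) =
        cnt A (Suc j) (\<lambda>s ys. i = m \<and> pom_forest M k s ys)" by (rule cnt_cong)
    then show ?thesis by (simp add: cnt_False)
  qed
  have 3: "cnt A (Suc j) (\<lambda>s ys. eoc_pom_inner m M k s (ins_leaf i (Suc (Suc p)) ys)) =
      cnt A (Suc j) (eoc_pom_inner m M k)" if "p < j" for p
  proof (rule cnt_cong)
    fix s ys assume F: "(s, ys) \<in> forests A (Suc j)"
    then obtain a b zs where ys: "ys = a # b # zs" using forests_two[OF F \<open>p < j\<close>] by blast
    show "eoc_pom_inner m M k s (ins_leaf i (Suc (Suc p)) ys) = eoc_pom_inner m M k s ys"
      using pom_forest_ins_leaf[OF ik, of M s "Suc (Suc p)" ys]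
      by (simp add: eoc_pom_inner_def ys ins_leaf_Suc)
  qed
  have 40: "cnt A (Suc (Suc (Suc j))) (\<lambda>s ys. eoc_pom_inner m M k s (ins_node i 0 ys)) =
      cnt A (Suc (Suc (Suc j))) (eoc_pom_inner m M k)"
  proof (rule cnt_cong)
    fix s ys assume F: "(s, ys) \<in> forests A (Suc (Suc (Suc j)))"
    then obtain l r a zs where ys: "ys = l # r # a # zs" using len[of ys] unfolding forests_iff by blast
    have "eoc_pair (Node l i r) a = eoc_pair l r"
      using F roots_above(2)[OF F, of a] full_not_Leaf[of l]
      by (subst eoc_pair_least_left[of _ i]) (auto simp: ys eoc_Node forests_iff simp del: eoc.simps(2))
    then show "eoc_pom_inner m M k s (ins_node i 0 ys) = eoc_pom_inner m M k s ys"
      using pom_forest_ins_node[OF ik, of M s 0 l r "a # zs"]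
      by (simp add: eoc_pom_inner_def ys ins_node_0)
  qed
  have 41: "cnt A (Suc (Suc (Suc j))) (\<lambda>s ys. eoc_pom_inner m M k s (ins_node i (Suc 0) ys)) =
      cnt A (Suc (Suc (Suc j))) (eoc_pom_inner m M k)"
  proof (rule cnt_cong)
    fix s ys assume F: "(s, ys) \<in> forests A (Suc (Suc (Suc j)))"
    then obtain l r a zs where ys: "ys = l # r # a # zs" using len[of ys] unfolding forests_iff by blast
    have "eoc_pair a (Node l i r) = eoc_pair l r"
      using F roots_above(2)[OF F, of a] full_not_Leaf[of l]
      by (subst eoc_pair_least_right[of _ i]) (auto simp: ys eoc_Node forests_iff simp del: eoc.simps(2))
    then show "eoc_pom_inner m M k s (ins_node i (Suc 0) ys) = eoc_pom_inner m M k s ys"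
      using pom_forest_ins_node[OF ik, of M s "Suc 0" l r "a # zs"]
      by (simp add: eoc_pom_inner_def ys ins_node_0 ins_node_Suc)
  qed
  have 5: "cnt A (Suc (Suc (Suc j))) (\<lambda>s ys. eoc_pom_inner m M k s (ins_node i (Suc (Suc p)) ys)) =
      cnt A (Suc (Suc (Suc j))) (eoc_pom_inner m M k)" if "p < j" for p
  proof -
    \<comment> \<open>Here two freed subtrees precede the distinguished pair.\<close>
    let ?f = "\<lambda>ys. (ys ! 2) # (ys ! 3) # (ys ! 0) # (ys ! 1) # drop 4 ys :: nat tree list"
    have len4: "\<exists>l r a b zs. ys = l # r # a # b # zs" if "length ys = Suc (Suc (Suc j))" for ys :: "nat tree list"
    proof -
      have "length ys = Suc (Suc (Suc (Suc (j - 1))))" using that \<open>p < j\<close> by simp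
      then show ?thesis by (metis length_Suc_conv)
    qed
    have "cnt A (Suc (Suc (Suc j))) (\<lambda>s ys. eoc_pom_inner m M k s (ins_node i (Suc (Suc p)) ys)) =
        cnt A (Suc (Suc (Suc j))) (\<lambda>s ys. eoc_pom_inner m M k s (?f ys))"
    proof (rule cnt_cong)
      fix s ys assume F: "(s, ys) \<in> forests A (Suc (Suc (Suc j)))"
      then obtain l r a b zs where ys: "ys = l # r # a # b # zs" using len4[of ys] unfolding forests_iff by blast
      have "pom_forest M k s (?f ys) = pom_forest M k s ys"
        by (rule pom_forest_reorder) (auto simp: ys)
      then show "eoc_pom_inner m M k s (ins_node i (Suc (Suc p)) ys) = eoc_pom_inner m M k s (?f ys)"
        using pom_forest_ins_node[OF ik, of M s "Suc (Suc p)" l r "a # b # zs"]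
        by (simp add: eoc_pom_inner_def ys ins_node_Suc)
    qed
    also have "\<dots> = cnt A (Suc (Suc (Suc j))) (eoc_pom_inner m M k)"
    proof (rule cnt_reorder[OF fin])
      show "inj_on ?f {xs. length xs = Suc (Suc (Suc j))}"
        by (rule inj_onI) (auto dest!: len4)
      show "mset (?f xs) = mset xs" if "length xs = Suc (Suc (Suc j))" for xs
        using len4[OF that] by auto
    qed
    finally show ?thesis .
  qed
  show ?thesis
    by (simp add: insert_rule 1 sum.lessThan_Suc_shift 20 21 3 40 41 5 eval_nat_numeral del: sum.lessThan_Suc)
qed

end

section \<open>Removal of k, the parent of the largest label\<close>

lemma count_forest:
  assumes "(s, xs) \<in> forests A j" "finite A"
  shows "count (mset_tree s) a + count (sum_list (map mset_tree xs)) a \<le> 1"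
proof -
  have "count (mset_tree s + sum_list (map mset_tree xs)) a \<le> 1"
    using assms by (cases "a \<in> A") (simp_all add: forests_iff)
  then show ?thesis by simp
qed

lemma count_tree_le_forest:
  assumes "x \<in> set xs"
  shows "count (mset_tree x) a \<le> count (sum_list (map mset_tree xs)) a"
  using assms by (induction xs) auto

lemma max_root:
  assumes "heap t" "\<And>a. a \<in> set_tree t \<Longrightarrow> a \<le> M" "count (mset_tree t) M \<le> 1" "M \<in> root_labels t"
  shows "t = Node Leaf M Leaf"
proof (cases t)
  case (Node l a r)
  have "a = M" using assms(4) Node by simp
  have "M \<notin> set_tree l \<union> set_tree r"
    using assms(3) by (simp add: Node \<open>a = M\<close> flip: set_mset_tree count_greater_zero_iff)
  moreover have "b = M" if "b \<in> set_tree l \<union> set_tree r" for b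
    using assms(1) assms(2)[of b] that by (auto simp: Node \<open>a = M\<close> intro: antisym)
  ultimately have "set_tree l \<union> set_tree r = {}" by blast
  then show ?thesis using Node \<open>a = M\<close> by simp
qed (use assms in simp)

lemma cnt_leaf_front:
  assumes "finite A" "M \<in> A"
  shows "cnt A (Suc j) (\<lambda>s ys. hd ys = Node Leaf M Leaf) = cnt (A - {M}) j (\<lambda>_ _. True)"
proof -
  let ?f = "\<lambda>(s::nat tree, ys). (s, Node Leaf M Leaf # ys)"
  have M: "mset_set A = add_mset M (mset_set (A - {M}))"
    using assms by (simp add: mset_set.remove)
  have "{(s, ys). (s, ys) \<in> forests A (Suc j) \<and> hd ys = Node Leaf M Leaf} = ?f ` forests (A - {M}) j"
  proof (intro equalityI subsetI)
    fix F assume "F \<in> {(s, ys). (s, ys) \<in> forests A (Suc j) \<and> hd ys = Node Leaf M Leaf}"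
    then obtain s ys where F: "F = (s, ys)" "(s, ys) \<in> forests A (Suc j)" "hd ys = Node Leaf M Leaf"
      by blast
    then obtain zs where ys: "ys = Node Leaf M Leaf # zs" by (cases ys) (auto simp: forests_iff)
    have "(s, zs) \<in> forests (A - {M}) j" using F(2) by (simp add: ys forests_iff M)
    then show "F \<in> ?f ` forests (A - {M}) j" using F ys by force
  qed (auto simp: forests_iff M)
  moreover have "inj_on ?f (forests (A - {M}) j)" by (auto simp: inj_on_def)
  ultimately show ?thesis by (simp add: cnt_def card_image)
qed

text \<open>Being largest, M forms a one-node subtree. If k is the spine root, M must be its left
  child; at each of the j list positions M may be the left or the right child. This makes 1 + 2j
  choices, after each of which M is deleted as well.\<close>

lemma cnt_pom_base:
  assumes fin: "finite A" and less: "\<And>a. a \<in> A \<Longrightarrow> k < a" and M: "M \<in> A" "\<And>a. a \<in> A \<Longrightarrow> a \<le> M"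
  shows "cnt (insert k A) j (pom_forest M k) = (2 * j + 1) * cnt (A - {M}) j (\<lambda>_ _. True)"
proof -
  let ?m = "Node Leaf M Leaf"
  have no: "\<not> pom_forest M k s ys" if F: "(s, ys) \<in> forests A n" for s ys n
    using parent_of_label[of M k] forests_labels(1,2)[OF F fin] less[of k]
    unfolding pom_forest_def by blast
  have root: "M \<in> root_labels x \<longleftrightarrow> x = ?m" if F: "(s, ys) \<in> forests A n" and "x = s \<or> x \<in> set ys" for s ys n x
  proof
    assume "M \<in> root_labels x"
    have "count (mset_tree x) M \<le> 1"
      using count_forest[OF F fin, of M] count_tree_le_forest[of x ys M] \<open>x = s \<or> _\<close> by force
    then show "x = ?m"
      using F \<open>x = s \<or> _\<close> forests_labels(1,2)[OF F fin] M(2) \<open>M \<in> root_labels x\<close>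
      by (intro max_root) (auto simp: forests_iff)
  qed simp
  have 1: "cnt A (Suc j) (\<lambda>s ys. pom_forest M k (Node (hd ys) k s) (tl ys)) = cnt (A - {M}) j (\<lambda>_ _. True)"
  proof -
    have "cnt A (Suc j) (\<lambda>s ys. pom_forest M k (Node (hd ys) k s) (tl ys)) =
        cnt A (Suc j) (\<lambda>s ys. hd ys = ?m)"
    proof (rule cnt_cong)
      fix s ys assume F: "(s, ys) \<in> forests A (Suc j)"
      then obtain l zs where ys: "ys = l # zs" by (cases ys) (auto simp: forests_iff)
      \<comment> \<open>A one-node tree has no left subtree and so is not a \<open>spine\<close>
        tree: M cannot be the right child of the spine root.\<close>
      have "s \<noteq> ?m" using F by (auto simp: forests_iff)
      then show "pom_forest M k (Node (hd ys) k s) (tl ys) \<longleftrightarrow> hd ys = ?m"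
        using no[OF F] root[OF F] by (auto simp: ys pom_forest_def child_labels_def)
    qed
    then show ?thesis by (simp add: cnt_leaf_front fin M)
  qed
  have 2: "cnt A (j - 1) (\<lambda>s ys. pom_forest M k s (ins_leaf k p ys)) = 0" for p
  proof (rule cnt_False)
    fix s ys assume F: "(s, ys) \<in> forests A (j - 1)"
    have "set ys = set (take p ys) \<union> set (drop p ys)"
      by (metis append_take_drop_id set_append)
    then show "\<not> pom_forest M k s (ins_leaf k p ys)"
      using no[OF F] by (auto simp: pom_forest_def ins_leaf_def child_labels_def)
  qed
  have 3: "cnt A (Suc j) (\<lambda>s ys. pom_forest M k s (ins_node k p ys)) = 2 * cnt (A - {M}) j (\<lambda>_ _. True)"
    if "p < j" for p
  proof -
    have "cnt A (Suc j) (\<lambda>s ys. pom_forest M k s (ins_node k p ys)) =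
        cnt A (Suc j) (\<lambda>s ys. hd ys = ?m \<or> ys ! 1 = ?m)"
    proof (rule cnt_cong)
      fix s ys assume F: "(s, ys) \<in> forests A (Suc j)"
      then obtain l r zs where ys: "ys = l # r # zs" using forests_two[OF _ \<open>p < j\<close>] by blast
      have "set zs = set (take p zs) \<union> set (drop p zs)"
        by (metis append_take_drop_id set_append)
      then show "pom_forest M k s (ins_node k p ys) \<longleftrightarrow> hd ys = ?m \<or> ys ! 1 = ?m"
        using no[OF F] root[OF F, of l] root[OF F, of r]
        by (auto simp: ys pom_forest_def ins_node_def child_labels_def)
    qed
    also have "\<dots> = cnt A (Suc j) (\<lambda>s ys. hd ys = ?m) + cnt A (Suc j) (\<lambda>s ys. ys ! 1 = ?m)"
    proof (rule cnt_disj[OF fin])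
      fix s ys assume F: "(s, ys) \<in> forests A (Suc j)"
      then obtain l r zs where ys: "ys = l # r # zs" using forests_two[OF _ \<open>p < j\<close>] by blast
      show "\<not> (hd ys = ?m \<and> ys ! 1 = ?m)" using count_forest[OF F fin, of M] by (auto simp: ys)
    qed
    \<comment> \<open>Swapping the first two trees reduces a right child M to a left child
      M.\<close>
    also have "cnt A (Suc j) (\<lambda>s ys. ys ! 1 = ?m) =
        cnt A (Suc j) (\<lambda>s ys. hd ((ys ! 1) # (ys ! 0) # drop 2 ys) = ?m)" by simp
    also have "\<dots> = cnt A (Suc j) (\<lambda>s ys. hd ys = ?m)"
    proof (rule cnt_reorder[OF fin])
      have len: "\<exists>l r zs. ys = l # r # zs" if "length ys = Suc j" for ys :: "nat tree list"
      proof -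
        have "length ys = Suc (Suc (j - 1))" using that \<open>p < j\<close> by simp
        then show ?thesis by (metis length_Suc_conv)
      qed
      show "inj_on (\<lambda>ys. (ys ! 1) # (ys ! 0) # drop 2 ys :: nat tree list) {xs. length xs = Suc j}"
        by (rule inj_onI) (auto dest!: len)
      show "mset ((ys ! 1) # (ys ! 0) # drop 2 ys) = mset ys" if "length ys = Suc j" for ys :: "nat tree list"
        using len[OF that] by auto
    qed
    finally show ?thesis by (simp add: cnt_leaf_front fin M)
  qed
  show ?thesis
    by (simp add: cnt_insert[OF fin less] 1 2 3 del: One_nat_def)
      (simp add: algebra_simps)
qed

text \<open>A chain ends at a label that is present. Hence, when i = m is removed, only the source
  terms of the two recursions remain.\<close>

lemma cnt_eoc_absent:
  assumes "finite A" "m \<notin> A"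
  shows "cnt A (j + 1) (eoc_pom_spine m M k) = 0" "cnt A (j + 2) (eoc_pom_inner m M k) = 0"
proof -
  have "\<not> eoc_pom_spine m M k s ys" if F: "(s, ys) \<in> forests A (Suc j)" for s ys
  proof -
    obtain l zs where ys: "ys = l # zs" using F by (cases ys) (auto simp: forests_iff)
    have "full l" using F by (auto simp: ys forests_iff)
    then show ?thesis
      using eoc_pair_in[of l s] full_not_Leaf[of l] assms(2) forests_labels(1)[OF F assms(1)]
        forests_labels(2)[OF F assms(1), of l]
      by (auto simp: eoc_pom_spine_def ys)
  qed
  then show "cnt A (j + 1) (eoc_pom_spine m M k) = 0" by (simp add: cnt_False)
  have "\<not> eoc_pom_inner m M k s ys" if F: "(s, ys) \<in> forests A (Suc (Suc j))" for s ys
  proof -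
    obtain l r zs where ys: "ys = l # r # zs" using forests_two[OF F] by blast
    have "full l" using F by (auto simp: ys forests_iff)
    then show ?thesis
      using eoc_pair_in[of l r] full_not_Leaf[of l] assms(2)
        forests_labels(2)[OF F assms(1), of l] forests_labels(2)[OF F assms(1), of r]
      by (auto simp: eoc_pom_inner_def ys)
  qed
  then show "cnt A (j + 2) (eoc_pom_inner m M k) = 0" by (simp add: cnt_False)
qed

lemma odd_size_full: "full t \<Longrightarrow> odd (size t)"
  by (induction t) auto

lemma even_size_spine: "spine t \<Longrightarrow> even (size t)"
  by (induction t) (auto dest: odd_size_full)

text \<open>Full trees have odd and spine trees even size. This accounts for the coefficients of odd
  total degree, to which no tree of the theorem corresponds.\<close>

lemma cnt_parity:
  assumes "odd (card A + j)"
  shows "cnt A j P = 0"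
proof (rule cnt_False)
  fix s xs assume F: "(s, xs) \<in> forests A j"
  have "even (sum_list (map size xs)) \<longleftrightarrow> even (length xs)" if "\<forall>x\<in>set xs. full x" for xs :: "nat tree list"
    using that by (induction xs) (auto dest: odd_size_full)
  then show "\<not> P s xs"
    using F forests_size[OF F] even_size_spine[of s] assms by (auto simp: forests_iff simp flip: forests_size[OF F])
qed

section \<open>Complete increasing trees as forests\<close>

text \<open>Phrased by multiplicities because forests are specified by multisets of labels.\<close>

definition distinct_tree :: "'a tree \<Rightarrow> bool" where
  "distinct_tree t \<longleftrightarrow> (\<forall>a. count (mset_tree t) a \<le> 1)"

lemma distinct_tree_Node:
  "distinct_tree (Node l a r) \<longleftrightarrow> distinct_tree l \<and> distinct_tree r \<and> a \<notin> set_tree l \<and> a \<notin> set_tree r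
     \<and> set_tree l \<inter> set_tree r = {}" (is "?L \<longleftrightarrow> ?R")
proof
  assume L: ?L
  have c: "count (mset_tree l) b + count (mset_tree r) b + (if b = a then 1 else 0) \<le> 1" for b
    using L[unfolded distinct_tree_def, rule_format, of b] by (simp split: if_splits)
  have "b \<notin> set_tree l \<or> b \<notin> set_tree r" for b
    using c[of b] by (simp flip: set_mset_tree count_greater_zero_iff) linarith
  moreover have "a \<notin> set_tree l \<and> a \<notin> set_tree r"
    using c[of a] by (simp flip: set_mset_tree count_greater_zero_iff)
  ultimately show ?R using c by (fastforce simp: distinct_tree_def intro: order_trans[rotated])
next
  assume R: ?R
  have "count (mset_tree (Node l a r)) b \<le> 1" for b
  proof -
    consider "b \<notin> set_tree l" "b \<notin> set_tree r" | "b \<in> set_tree l" "b \<notin> set_tree r" "b \<noteq> a"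
      | "b \<notin> set_tree l" "b \<in> set_tree r" "b \<noteq> a"
      using R by blast
    then show ?thesis
      using R by cases (auto simp: distinct_tree_def simp flip: set_mset_tree simp: not_in_iff)
  qed
  then show ?L by (simp add: distinct_tree_def)
qed

lemma rightmost_in: "rightmost t \<in> subtrees t"
  by (induction t) auto

lemma subtrees_labels: "Node l a r \<in> subtrees t \<Longrightarrow> a \<in> set_tree t"
  by (induction t) auto

lemma subtrees_size: "u \<in> subtrees t \<Longrightarrow> size u \<le> size t"
  by (induction t) auto

lemma rightmost_not_Leaf: "t \<noteq> Leaf \<Longrightarrow> rightmost t \<noteq> Leaf"
  by (induction t) auto

lemma all_subtrees_Node:
  "(\<forall>l' a' r'. Node l' a' r' \<in> subtrees (Node l a r) \<longrightarrow> Q l' a' r') \<longleftrightarrow>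
     Q l a r \<and> (\<forall>l' a' r'. Node l' a' r' \<in> subtrees l \<longrightarrow> Q l' a' r') \<and>
     (\<forall>l' a' r'. Node l' a' r' \<in> subtrees r \<longrightarrow> Q l' a' r')"
  by auto

lemma full_iff:
  "(\<forall>l a r. Node l a r \<in> subtrees t \<longrightarrow> (l = Leaf \<longleftrightarrow> r = Leaf)) \<longleftrightarrow> t = Leaf \<or> full t"
proof (induction t)
  case (Node l a r)
  have "(\<forall>l' a' r'. Node l' a' r' \<in> subtrees (Node l a r) \<longrightarrow> (l' = Leaf \<longleftrightarrow> r' = Leaf)) \<longleftrightarrow>
      (l = Leaf \<longleftrightarrow> r = Leaf) \<and> (l = Leaf \<or> full l) \<and> (r = Leaf \<or> full r)"
    unfolding all_subtrees_Node Node.IH ..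
  then show ?case by auto
qed simp

text \<open>Completeness identifies the rightmost node with the subtree rooted there. Distinct
  labels ensure that this subtree does not also occur inside a left subtree, where it would wrongly
  receive the exceptional condition.\<close>

lemma spine_iff:
  assumes "distinct_tree t" "t \<noteq> Leaf"
  shows "(\<forall>l a r. Node l a r \<in> subtrees t \<longrightarrow>
      (if Node l a r = rightmost t then l \<noteq> Leaf \<and> r = Leaf else l = Leaf \<longleftrightarrow> r = Leaf)) \<longleftrightarrow> spine t"
  using assms
proof (induction t)
  case (Node l a r)
  show ?case
  proof (cases "r = Leaf")
    case True
    have ne: "u \<noteq> Node l a r" if "u \<in> subtrees l" for u
      using subtrees_size[OF that] by auto
    have "(\<forall>l' a' r'. Node l' a' r' \<in> subtrees (Node l a r) \<longrightarrow>
        (if Node l' a' r' = rightmost (Node l a r) then l' \<noteq> Leaf \<and> r' = Leaf else l' = Leaf \<longleftrightarrow> r' = Leaf)) \<longleftrightarrow>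
        l \<noteq> Leaf \<and> (\<forall>l' a' r'. Node l' a' r' \<in> subtrees l \<longrightarrow> (l' = Leaf \<longleftrightarrow> r' = Leaf))"
      using True ne by auto
    then show ?thesis using True unfolding full_iff by auto
  next
    case False
    obtain l0 a0 r0 where rm: "rightmost r = Node l0 a0 r0"
      using rightmost_not_Leaf[OF False] by (cases "rightmost r") auto
    have rmr: "Node l0 a0 r0 \<in> subtrees r" using rightmost_in[of r] by (simp add: rm)
    have nl: "u \<noteq> Node l0 a0 r0" if "u \<in> subtrees l" for u
      using subtrees_labels[of l0 a0 r0 l] subtrees_labels[OF rmr] that Node.prems
      by (auto simp: distinct_tree_Node)
    have nt: "Node l a r \<noteq> rightmost r"
    proof
      assume eq: "Node l a r = rightmost r"
      show False using subtrees_size[OF rightmost_in[of r]] unfolding eq[symmetric] by simp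
    qed
    have rt: "rightmost (Node l a r) = rightmost r"
      using False by simp
    have "(\<forall>l' a' r'. Node l' a' r' \<in> subtrees (Node l a r) \<longrightarrow>
        (if Node l' a' r' = rightmost (Node l a r) then l' \<noteq> Leaf \<and> r' = Leaf else l' = Leaf \<longleftrightarrow> r' = Leaf)) \<longleftrightarrow>
        l \<noteq> Leaf \<and> (\<forall>l' a' r'. Node l' a' r' \<in> subtrees l \<longrightarrow> (l' = Leaf \<longleftrightarrow> r' = Leaf)) \<and>
        (\<forall>l' a' r'. Node l' a' r' \<in> subtrees r \<longrightarrow>
        (if Node l' a' r' = rightmost r then l' \<noteq> Leaf \<and> r' = Leaf else l' = Leaf \<longleftrightarrow> r' = Leaf))"
      (is "?A \<longleftrightarrow> ?B")
    proof -
      have "?A \<longleftrightarrow> (l = Leaf \<longleftrightarrow> r = Leaf) \<and> (\<forall>l' a' r'. Node l' a' r' \<in> subtrees l \<longrightarrow>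
          (if Node l' a' r' = rightmost r then l' \<noteq> Leaf \<and> r' = Leaf else l' = Leaf \<longleftrightarrow> r' = Leaf)) \<and>
        (\<forall>l' a' r'. Node l' a' r' \<in> subtrees r \<longrightarrow>
          (if Node l' a' r' = rightmost r then l' \<noteq> Leaf \<and> r' = Leaf else l' = Leaf \<longleftrightarrow> r' = Leaf))"
        unfolding all_subtrees_Node rt if_not_P[OF nt] ..
      also have "\<dots> \<longleftrightarrow> ?B"
      proof -
        have "Node l' a' r' \<noteq> rightmost r" if "Node l' a' r' \<in> subtrees l" for l' a' r'
          using nl[OF that] unfolding rm .
        then have "(\<forall>l' a' r'. Node l' a' r' \<in> subtrees l \<longrightarrow>
            (if Node l' a' r' = rightmost r then l' \<noteq> Leaf \<and> r' = Leaf else l' = Leaf \<longleftrightarrow> r' = Leaf)) \<longleftrightarrow>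
          (\<forall>l' a' r'. Node l' a' r' \<in> subtrees l \<longrightarrow> (l' = Leaf \<longleftrightarrow> r' = Leaf))"
          by (intro all_cong1 imp_cong refl) (simp only: if_False)
        then show ?thesis using False by blast
      qed
      finally show ?thesis .
    qed
    also have "\<dots> \<longleftrightarrow> full l \<and> spine r"
      using Node.IH(2) Node.prems False unfolding full_iff by (auto simp: distinct_tree_Node)
    finally show ?thesis by simp
  qed
qed simp

text \<open>Comparing with the children suffices by transitivity; \<open>heap\<close> is non-strict,
  and distinctness of labels supplies the strictness.\<close>

lemma heap_iff:
  fixes t :: "nat tree"
  assumes "distinct_tree t"
  shows "(\<forall>l a r. Node l a r \<in> subtrees t \<longrightarrow> (\<forall>b\<in>child_labels l r. a < b)) \<longleftrightarrow> heap t"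
  using assms
proof (induction t)
  case (Node l a r)
  have le: "a < x" if "heap t" "\<forall>b\<in>root_labels t. a < b" "x \<in> set_tree t" for t x
    using that by (cases t) (auto intro: less_le_trans)
  have "(\<forall>l' a' r'. Node l' a' r' \<in> subtrees (Node l a r) \<longrightarrow> (\<forall>b\<in>child_labels l' r'. a' < b)) \<longleftrightarrow>
      (\<forall>b\<in>child_labels l r. a < b) \<and> heap l \<and> heap r"
    unfolding all_subtrees_Node using Node by (simp add: distinct_tree_Node)
  also have "\<dots> \<longleftrightarrow> heap (Node l a r)"
  proof
    assume h: "(\<forall>b\<in>child_labels l r. a < b) \<and> heap l \<and> heap r"
    have "a < x" if "x \<in> set_tree l \<union> set_tree r" for x
      using that h le[of l x] le[of r x] unfolding child_labels_def by blast
    then show "heap (Node l a r)" using h by (simp add: less_imp_le)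
  next
    assume h: "heap (Node l a r)"
    have "a < b" if "b \<in> set_tree l \<union> set_tree r" for b
    proof -
      have "a \<le> b" using h that by simp
      moreover have "a \<noteq> b" using that Node.prems by (auto simp: distinct_tree_Node)
      ultimately show ?thesis by simp
    qed
    then show "(\<forall>b\<in>child_labels l r. a < b) \<and> heap l \<and> heap r"
      using h root_labels_subset[of l] root_labels_subset[of r] unfolding child_labels_def by auto
  qed
  finally show ?case .
qed simp

section \<open>The parent of the largest label, and the removal of the root\<close>

lemma parent_of_iff:
  "(\<exists>l r. Node l k r \<in> subtrees t \<and> M \<in> child_labels l r) \<longleftrightarrow> parent_of M k t"
  by (induction t) auto

lemma parent_exists: "M \<in> set_tree t \<Longrightarrow> M \<notin> root_labels t \<Longrightarrow> \<exists>k. parent_of M k t"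
proof (induction t)
  case (Node l a r)
  then show ?case by (auto simp: child_labels_def)
qed simp

lemma parent_of_below:
  "parent_of M k (Node l a r) \<Longrightarrow> M \<in> set_tree l \<union> set_tree r"
proof (induction "Node l a r" arbitrary: l a r)
  case (Node l a r)
  have "M \<in> set_tree t" if "parent_of M k t" "t \<in> {l, r}" for t
    using that Node.hyps by (cases t) auto
  then show ?case using Node.prems root_labels_subset[of l] root_labels_subset[of r]
    by (auto simp: child_labels_def)
qed

lemma parent_of_in:
  assumes "parent_of M k t" "distinct_tree t"
  shows "M \<in> set_tree t \<and> M \<notin> root_labels t"
proof (cases t)
  case (Node l a r)
  then have "M \<in> set_tree l \<union> set_tree r" using assms(1) parent_of_below by blast
  then show ?thesis using assms(2) by (auto simp: Node distinct_tree_Node)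
qed (use assms in simp)

lemma parent_unique:
  assumes "distinct_tree t" "parent_of M k t" "parent_of M k' t"
  shows "k = k'"
  using assms
proof (induction t)
  case (Node l a r)
  have d: "set_tree l \<inter> set_tree r = {}" "distinct_tree l" "distinct_tree r"
    using Node.prems by (simp_all add: distinct_tree_Node)
  have "M \<notin> child_labels l r \<and> \<not> parent_of M k' r" if "parent_of M k l" for k k'
    using parent_of_in[OF that d(2)] parent_of_in[of M k' r] d root_labels_subset[of r] unfolding child_labels_def by blast
  moreover have "M \<notin> child_labels l r \<and> \<not> parent_of M k' l" if "parent_of M k r" for k k'
    using parent_of_in[OF that d(3)] parent_of_in[of M k' l] d root_labels_subset[of l] unfolding child_labels_def by blast
  moreover have "parent_of M k l \<and> parent_of M k' l \<longrightarrow> k = k'" "parent_of M k r \<and> parent_of M k' r \<longrightarrow> k = k'"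
    using Node.IH d by blast+
  ultimately show ?case
    using Node.prems(2,3) unfolding parent_of.simps by blast
qed simp

lemma pom_eq_iff:
  assumes "distinct_tree t" "size t \<in> set_tree t" "size t \<notin> root_labels t"
  shows "pom t = k \<longleftrightarrow> parent_of (size t) k t"
proof -
  obtain k0 where "parent_of (size t) k0 t" using parent_exists assms by blast
  moreover from this have "pom t = k0"
    unfolding pom_def parent_of_iff
    using parent_unique[OF assms(1)] by (intro the_equality) blast+
  ultimately show ?thesis using parent_unique[OF assms(1)] by blast
qed

lemma mset_tree_set:
  assumes "size t = card (set_tree t)"
  shows "mset_tree t = mset_set (set_tree t)"
proof -
  have "distinct (inorder t)" using assms by (simp add: card_distinct)
  from mset_set_set[OF this] show ?thesis by simp
qed

text \<open>Removing the root 1 starts the process: the right subtree is the spine and the left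
  subtree the only pending tree, already distinguished as its sibling.\<close>

lemma complete_increasing_iff:
  assumes "even N" "N \<ge> 2"
  shows "t \<in> complete_increasing_trees N \<longleftrightarrow> (\<exists>l r. t = Node l 1 r \<and> (r, [l]) \<in> forests {2..N} 1)"
proof -
  have N1: "mset_set {1..N} = add_mset 1 (mset_set {2..N})"
    using assms(2) by (subst atLeastAtMost_insertL[symmetric]) (auto simp: numeral_2_eq_2)
  have "t \<in> complete_increasing_trees N \<longleftrightarrow>
      mset_tree t = mset_set {1..N} \<and> root_labels t = {1} \<and> heap t \<and> spine t"
  proof (cases "mset_tree t = mset_set {1..N}")
    case True
    have st: "size t = N" "set_tree t = {1..N}"
      using arg_cong[OF True, of size] arg_cong[OF True, of set_mset] by simp_all
    have d: "distinct_tree t" by (simp add: distinct_tree_def True count_mset_set')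
    have "t \<noteq> Leaf" using st assms by auto
    have "complete_tree t \<longleftrightarrow> spine t"
      unfolding spine_iff[OF d \<open>t \<noteq> Leaf\<close>, symmetric] complete_tree_def using st assms by simp
    then show ?thesis
      unfolding complete_increasing_trees_def increasing_tree_def mem_Collect_eq heap_iff[OF d]
      using st True by auto
  next
    case False
    then show ?thesis using mset_tree_set[of t]
      by (auto simp: complete_increasing_trees_def increasing_tree_def)
  qed
  also have "\<dots> \<longleftrightarrow> (\<exists>l r. t = Node l 1 r \<and> (r, [l]) \<in> forests {2..N} 1)"
  proof
    assume h: "mset_tree t = mset_set {1..N} \<and> root_labels t = {1} \<and> heap t \<and> spine t"
    then obtain l r where "t = Node l 1 r" by (cases t) auto
    then show "\<exists>l r. t = Node l 1 r \<and> (r, [l]) \<in> forests {2..N} 1"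
      using h by (auto simp: forests_iff N1 add.commute simp del: One_nat_def)
  next
    assume "\<exists>l r. t = Node l 1 r \<and> (r, [l]) \<in> forests {2..N} 1"
    then obtain l r where t: "t = Node l 1 r" and F: "(r, [l]) \<in> forests {2..N} 1" by blast
    have "set_tree r \<subseteq> {2..N}" "set_tree l \<subseteq> {2..N}" using forests_labels[OF F] by auto
    then show "mset_tree t = mset_set {1..N} \<and> root_labels t = {1} \<and> heap t \<and> spine t"
      using F by (auto simp: t forests_iff N1 add.commute simp del: One_nat_def)
  qed
  finally show ?thesis .
qed

text \<open>For k at least 2 the root is not the parent of N, so its removal does not lose the
  statistic pom.\<close>

lemma eoc_pom_count_eq:
  assumes "even N" "N \<ge> 2" "k \<ge> 2"
  shows "eoc_pom_count N m k = cnt {2..N} 1 (eoc_pom_spine m N k)"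
proof -
  let ?f = "\<lambda>(s, xs). Node (hd xs) 1 s :: nat tree"
  have stat: "eoc (Node l 1 r) = m \<and> pom (Node l 1 r) = k \<longleftrightarrow> eoc_pom_spine m N k r [l]"
    if F: "(r, [l]) \<in> forests {2..N} 1" for l r
  proof -
    let ?t = "Node l 1 r"
    have "l \<noteq> Leaf" using F by (auto simp: forests_iff)
    have N: "size ?t = N" using forests_size[OF F] assms(2) by simp
    have sub: "set_tree r \<subseteq> {2..N}" "set_tree l \<subseteq> {2..N}" using forests_labels[OF F] by auto
    have "count (mset_tree ?t) a \<le> 1" for a
    proof (cases "a = 1")
      case True
      then show ?thesis using sub by (auto simp: not_in_iff simp flip: set_mset_tree)
    next
      case False
      then show ?thesis using count_forest[OF F, of a] by simp
    qed
    then have d: "distinct_tree ?t" by (simp add: distinct_tree_def)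
    have "N \<in> set_tree ?t" using forests_labels(3)[OF F, of N] assms(2) by auto
    moreover have "N \<notin> root_labels ?t" using assms(2) by simp
    ultimately have "pom ?t = k \<longleftrightarrow> parent_of N k ?t"
      using pom_eq_iff[OF d, of k] unfolding N by blast
    also have "\<dots> \<longleftrightarrow> pom_forest N k r [l]"
      using assms(3) by (auto simp: pom_forest_def)
    finally show ?thesis using \<open>l \<noteq> Leaf\<close> by (simp add: eoc_pom_spine_def eoc_Node del: eoc.simps)
  qed
  have sing: "\<exists>l. xs = [l]" if "(s, xs) \<in> forests {2..N} 1" for s xs
    using that by (cases xs) (auto simp: forests_iff)
  define Z where "Z = {(s, xs). (s, xs) \<in> forests {2..N} 1 \<and> eoc_pom_spine m N k s xs}"
  have "{t \<in> complete_increasing_trees N. eoc t = m \<and> pom t = k} = ?f ` Z"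
  proof (intro equalityI subsetI)
    fix t assume "t \<in> {t \<in> complete_increasing_trees N. eoc t = m \<and> pom t = k}"
    then obtain l r where t: "t = Node l 1 r" "(r, [l]) \<in> forests {2..N} 1" "eoc t = m \<and> pom t = k"
      using complete_increasing_iff[OF assms(1,2)] by blast
    then have "(r, [l]) \<in> Z" using stat[OF t(2)] by (simp add: Z_def)
    then show "t \<in> ?f ` Z" using t(1) by force
  next
    fix t assume "t \<in> ?f ` Z"
    then obtain s xs where t: "t = Node (hd xs) 1 s" "(s, xs) \<in> forests {2..N} 1" "eoc_pom_spine m N k s xs"
      by (auto simp: Z_def)
    obtain l where l: "xs = [l]" using sing[OF t(2)] by blast
    have F: "(s, [l]) \<in> forests {2..N} 1" using t(2) l by simp
    then have "eoc t = m \<and> pom t = k" using stat[OF F] t l by simp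
    moreover have "t \<in> complete_increasing_trees N"
      using complete_increasing_iff[OF assms(1,2)] F t(1) l by auto
    ultimately show "t \<in> {t \<in> complete_increasing_trees N. eoc t = m \<and> pom t = k}" by simp
  qed
  moreover have "inj_on ?f Z"
    by (rule inj_onI) (auto simp: Z_def simp del: One_nat_def dest!: sing)
  moreover have "card Z = cnt {2..N} 1 (eoc_pom_spine m N k)"
    by (simp add: Z_def cnt_def)
  ultimately show ?thesis
    by (simp add: eoc_pom_count_def card_image)
qed

section \<open>Counting numbers as Taylor coefficients\<close>

abbreviation full_cnt :: "nat set \<Rightarrow> nat \<Rightarrow> nat" where
  "full_cnt A j \<equiv> cnt A j (\<lambda>_ _. True)"

lemma coeff3_Suc:
  "fact (Suc a) * coeff3 F (Suc a) b c = fact a * coeff3 (dx F) a b c"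
  "fact (Suc b) * coeff3 F a (Suc b) c = fact b * coeff3 (dy F) a b c"
  "fact (Suc c) * coeff3 F a b (Suc c) = fact c * coeff3 (dz F) a b c"
  by (simp_all add: coeff3_dx coeff3_dy coeff3_dz)

lemma coeff3_0_X_gf: "coeff3 (X_gf j) 0 0 0 = (if j = 0 then 1 else 0)"
proof -
  have "coeff3 (lcos 1 1 1) 0 0 0 * coeff3 sec_s 0 0 0 = 1"
    by (simp add: cos_sec coeff3_one flip: coeff3_0_mult)
  moreover have "coeff3 tan_s 0 0 0 = 0"
    by (simp add: tan_s_def coeff3_0_mult coeff3_0_trig)
  ultimately show ?thesis
    by (cases j) (simp_all add: X_gf_def coeff3_0_mult coeff3_0_trig)
qed

lemma full_cnt_coeff:
  "finite A \<Longrightarrow> real (full_cnt A j) = fact (card A) * coeff3 (X_gf j) (card A) 0 0"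
proof (induction "card A" arbitrary: A j)
  case 0
  then show ?case by (simp add: cnt_empty coeff3_0_X_gf)
next
  case (Suc a)
  then have "A \<noteq> {}" by auto
  define i where "i = Min A"
  define B where "B = A - {i}"
  have A: "A = insert i B" "finite B" "\<And>b. b \<in> B \<Longrightarrow> i < b"
    using Suc.prems Min_in[OF Suc.prems \<open>A \<noteq> {}\<close>] by (auto simp: i_def B_def order.strict_iff_order)
  have B: "card B = a" using Suc.hyps(2) Suc.prems \<open>A \<noteq> {}\<close> by (simp add: B_def i_def)
  have IH: "real (full_cnt B j) = fact a * coeff3 (X_gf j) a 0 0" for j
    using Suc.hyps(1)[of B j] A(2) B by simp
  have "real (full_cnt A j) = real j * real (full_cnt B (j - 1)) + real (j + 1) * real (full_cnt B (j + 1))"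
    using cnt_True_insert[OF A(2,3), of j] by (simp add: algebra_simps flip: A(1))
  also have "\<dots> = fact a * coeff3 (dx (X_gf j)) a 0 0"
    unfolding IH D_X_gf coeff3_add coeff3_of_nat_mult by (simp add: algebra_simps)
  finally show ?case using Suc.hyps(2) by (simp flip: coeff3_Suc)
qed

lemma ev_z_coeff: "ev_z F = ev_z G \<Longrightarrow> coeff3 F a b 0 = coeff3 G a b 0"
  by (simp add: ev_z_eq_iff)

lemma ev_yz_coeff: "ev_yz F = ev_yz G \<Longrightarrow> coeff3 F a 0 0 = coeff3 G a 0 0"
  by (simp add: ev_yz_eq_iff)

lemma interval_insert: "(i::nat) \<le> N \<Longrightarrow> {i..N} = insert i {Suc i..N}"
  by (rule Icc_eq_insert_lb_nat)

text \<open>Here a counts the labels strictly between k and N, and b the labels from i up to k - 1.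
  At b = 0 both k and N are removed, leaving an unrestricted forest on a labels.\<close>

lemma pom_cnt_coeff:
  assumes "k + a + 1 = N" "i + b = k"
  shows "real (cnt {i..N} j (pom_forest N k)) = fact a * fact b * coeff3 (Y_gf j) a b 0"
  using assms(2)
proof (induction b arbitrary: i j)
  case 0
  have I: "{i..N} = insert k {Suc k..N}" using 0 assms(1) interval_insert[of k N] by simp
  have R: "{Suc k..N} - {N} = {Suc k..<N}" using assms(1) by auto
  have "cnt {i..N} j (pom_forest N k) = (2 * j + 1) * full_cnt {Suc k..<N} j"
    unfolding I using assms(1) by (subst cnt_pom_base) (auto simp flip: R)
  moreover have "real (full_cnt {Suc k..<N} j) = fact a * coeff3 (X_gf j) a 0 0"
    using full_cnt_coeff[of "{Suc k..<N}" j] assms(1) by (simp flip: assms(1))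
  ultimately have "real (cnt {i..N} j (pom_forest N k)) = real (2 * j + 1) * (fact a * coeff3 (X_gf j) a 0 0)"
    by (simp only: of_nat_mult)
  also have "\<dots> = fact a * coeff3 (Y_gf j) a 0 0"
    unfolding ev_yz_coeff[OF ev_yz_Y_gf] coeff3_of_nat_mult by simp
  finally show ?case by simp
next
  case (Suc b)
  have I: "{i..N} = insert i {Suc i..N}" using Suc.prems assms(1) interval_insert[of i N] by simp
  have IH: "real (cnt {Suc i..N} j (pom_forest N k)) = fact a * fact b * coeff3 (Y_gf j) a b 0" for j
    using Suc by simp
  have "real (cnt {i..N} j (pom_forest N k)) =
      real j * real (cnt {Suc i..N} (j - 1) (pom_forest N k))
      + real (j + 1) * real (cnt {Suc i..N} (j + 1) (pom_forest N k))"
    unfolding I using Suc.prems by (subst cnt_pom_insert) (auto simp: algebra_simps)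
  also have "\<dots> = fact a * (fact b * coeff3 (dy (Y_gf j)) a b 0)"
    unfolding IH dy_Y_gf coeff3_add coeff3_of_nat_mult by (simp add: algebra_simps)
  finally show ?case by (simp add: mult.assoc flip: coeff3_Suc)
qed

text \<open>The exponents count labels: c from i up to m - 1, b strictly between m and k, a strictly
  between k and N. Both claims go through one induction because the spine recursion has the inner
  count as a source.\<close>

lemma eoc_pom_cnt_coeff:
  assumes "k + a + 1 = N" "m + b + 1 = k" "i + c = m"
  shows "real (cnt {i..N} (j + 1) (eoc_pom_spine m N k)) =
      fact a * fact b * fact c * coeff3 (S_gf j) a b c \<and>
    real (cnt {i..N} (j + 2) (eoc_pom_inner m N k)) =
      fact a * fact b * fact c * coeff3 (O_gf j) a b c"
  using assms(3)
proof (induction c arbitrary: i j)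
  case 0
  then have I: "{i..N} = insert i {Suc i..N}" "i = m" using assms interval_insert[of i N] by simp_all
  have ik: "i \<noteq> k" and lt: "\<And>a. a \<in> {Suc i..N} \<Longrightarrow> i < a" using I assms by auto
  have Y: "real (cnt {Suc i..N} j (pom_forest N k)) = fact a * fact b * coeff3 (Y_gf j) a b 0" for j
    using I assms by (intro pom_cnt_coeff) auto
  have z: "cnt {Suc i..N} (n + 1) (eoc_pom_spine m N k) = 0"
    "cnt {Suc i..N} (n + 2) (eoc_pom_inner m N k) = 0" for n
    using I by (intro cnt_eoc_absent; simp)+
  \<comment> \<open>For positive j these are the instances j - 1 of \<open>z\<close>; for j = 0 the
    lists are too short for \<open>z\<close>, but the factor vanishes.\<close>
  have z': "j * cnt {Suc i..N} j (eoc_pom_spine m N k) = 0"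
    "j * cnt {Suc i..N} (j + 1) (eoc_pom_inner m N k) = 0"
    using z(1)[of "j - 1"] z(2)[of "j - 1"] by (cases j; simp)+
  have "cnt {i..N} (j + 1) (eoc_pom_spine m N k) = cnt {Suc i..N} j (pom_forest N k)"
    unfolding I(1) using z(1)[of "j + 1"] z(2)[of j] z' I(2) lt
    by (subst cnt_spine_insert[OF _ _ ik]) auto
  moreover have "cnt {i..N} (j + 2) (eoc_pom_inner m N k) = 2 * cnt {Suc i..N} (j + 1) (pom_forest N k)"
    unfolding I(1) using z(2)[of "j + 1"] z' I(2) lt
    by (subst cnt_inner_insert[OF _ _ ik]) (auto simp: eval_nat_numeral)
  moreover have "coeff3 (2 * Y_gf (j + 1)) a b 0 = 2 * coeff3 (Y_gf (j + 1)) a b 0"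
    using coeff3_of_nat_mult[of 2] by simp
  ultimately show ?case
    using Y[of j] Y[of "j + 1"] ev_z_coeff[OF ev_z_S_gf] ev_z_coeff[OF ev_z_O_gf] by simp
next
  case (Suc c)
  have I: "{i..N} = insert i {Suc i..N}" using Suc.prems assms(1,2) interval_insert[of i N] by simp
  have ik: "i \<noteq> k" "i \<noteq> m" and lt: "\<And>a. a \<in> {Suc i..N} \<Longrightarrow> i < a" using Suc.prems assms by auto
  have IH: "real (cnt {Suc i..N} (j + 1) (eoc_pom_spine m N k)) =
      fact a * fact b * fact c * coeff3 (S_gf j) a b c"
    "real (cnt {Suc i..N} (j + 2) (eoc_pom_inner m N k)) =
      fact a * fact b * fact c * coeff3 (O_gf j) a b c" for j
    using Suc.IH[of "Suc i" j] Suc.prems by simp_all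
  have S': "real j * real (cnt {Suc i..N} j (eoc_pom_spine m N k)) =
      real j * (fact a * fact b * fact c * coeff3 (S_gf (j - 1)) a b c)"
    using IH(1)[of "j - 1"] by (cases j) simp_all
  have O': "real j * real (cnt {Suc i..N} (j + 1) (eoc_pom_inner m N k)) =
      real j * (fact a * fact b * fact c * coeff3 (O_gf (j - 1)) a b c)"
    using IH(2)[of "j - 1"] by (cases j) (simp_all add: eval_nat_numeral)
  have "real (cnt {i..N} (j + 1) (eoc_pom_spine m N k)) =
      real j * real (cnt {Suc i..N} j (eoc_pom_spine m N k))
      + real (j + 1) * real (cnt {Suc i..N} (j + 1 + 1) (eoc_pom_spine m N k))
      + real (cnt {Suc i..N} (j + 2) (eoc_pom_inner m N k))"
    unfolding I using ik(2) lt by (subst cnt_spine_insert[OF _ _ ik(1)]) (auto simp: algebra_simps)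
  also have "\<dots> = fact a * fact b * (fact c * coeff3 (dz (S_gf j)) a b c)"
    unfolding IH S' dz_S_gf coeff3_add coeff3_of_nat_mult by (simp add: algebra_simps)
  finally have 1: "real (cnt {i..N} (j + 1) (eoc_pom_spine m N k)) =
      fact a * fact b * (fact (Suc c) * coeff3 (S_gf j) a b (Suc c))"
    unfolding coeff3_Suc .
  have "real (cnt {i..N} (j + 2) (eoc_pom_inner m N k)) =
      real j * real (cnt {Suc i..N} (j + 1) (eoc_pom_inner m N k))
      + real (j + 3) * real (cnt {Suc i..N} (j + 1 + 2) (eoc_pom_inner m N k))"
    unfolding I using ik(2) lt
    by (subst cnt_inner_insert[OF _ _ ik(1)]) (auto simp: eval_nat_numeral algebra_simps)
  also have "\<dots> = fact a * fact b * (fact c * coeff3 (dz (O_gf j)) a b c)"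
    unfolding IH O' dz_O_gf coeff3_add coeff3_of_nat_mult by (simp add: algebra_simps)
  finally have 2: "real (cnt {i..N} (j + 2) (eoc_pom_inner m N k)) =
      fact a * fact b * (fact (Suc c) * coeff3 (O_gf j) a b (Suc c))"
    unfolding coeff3_Suc .
  from 1 2 show ?case by (simp only: mult.assoc simp_thms)
qed

section \<open>Assembling the generating function\<close>

lemma S_gf_0_coeff:
  "fact a * fact b * fact c * coeff3 (S_gf 0) a b c =
     (if even (a + b + c) then real (eoc_pom_count (a + b + c + 4) (c + 2) (b + c + 3)) else 0)"
proof -
  \<comment> \<open>The 4 stands for the labels 1, m, k and N, which no exponent counts. Accordingly
    m = c + 2 and k = b + c + 3.\<close>
  let ?N = "a + b + c + 4"
  have 1: "fact a * fact b * fact c * coeff3 (S_gf 0) a b c =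
      real (cnt {2..?N} 1 (eoc_pom_spine (c + 2) ?N (b + c + 3)))"
    by (rule sym, rule eoc_pom_cnt_coeff[where j = 0, THEN conjunct1, unfolded add_0]) auto
  have 2: "cnt {2..?N} 1 (eoc_pom_spine (c + 2) ?N (b + c + 3)) =
      (if even (a + b + c) then eoc_pom_count ?N (c + 2) (b + c + 3) else 0)"
  proof (cases "even (a + b + c)")
    case True
    then show ?thesis using eoc_pom_count_eq[of ?N "b + c + 3" "c + 2"] by simp
  next
    case False
    have "card {2..?N} + 1 = (a + b + c) + 4" by simp
    with False have "odd (card {2..?N} + 1)" by presburger
    from cnt_parity[OF this] show ?thesis by (simp only: False if_False)
  qed
  show ?thesis unfolding 1 2 by simp
qed

lemma S_gf_0_eq:
  "(cos3 (2 * Y3) + 2 * cos3 (2 * (X3 - Z3)) - cos3 (2 * (Z3 + X3)))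
     / (2 * cos3 (X3 + Y3 + Z3) ^ 3) = S_gf 0"
proof -
  have "cos3 (2 * Y3) = lcos 0 2 0" "cos3 (2 * (X3 - Z3)) = lcos 2 0 (- 2)"
    "cos3 (2 * (Z3 + X3)) = lcos 2 0 2" "cos3 (X3 + Y3 + Z3) = lcos 1 1 1"
    by (simp_all add: cos3_def lcomp_def lin_def cst_arith cst_numeral algebra_simps)
  moreover have "coeff3 (2 * lcos 1 1 1 ^ 3) 0 0 0 \<noteq> 0"
    by (simp add: power3_eq_cube coeff3_0_mult coeff3_0_trig coeff3_cst flip: cst_numeral)
  ultimately show ?thesis
    using fps3_divide_eq[OF S_gf_0] by simp
qed

text \<open>A factorial is a nonzero constant series, so each division is a scaling and what is left
  is a pure monomial.\<close>

lemma coeff3_monomial: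
  "coeff3 (of_nat f * (X3 ^ p / fact p) * (Y3 ^ q / fact q) * (Z3 ^ r / fact r)) a b c =
     (if a = p \<and> b = q \<and> c = r then real f / (fact a * fact b * fact c) else 0)"
proof -
  have div: "F / fact n = cst (1 / fact n) * F" for F :: fps3 and n
  proof (rule fps3_divide_eq)
    have f: "(fact n :: fps3) = cst (fact n)"
      using cst_of_nat[of "fact n"] by simp
    have "cst (1 / fact n) * fact n = 1"
      unfolding f cst_arith(2)[symmetric] by (simp add: cst_arith)
    then show "cst (1 / fact n) * F * fact n = F" by (simp add: mult_ac)
    show "coeff3 (fact n) 0 0 0 \<noteq> 0" by (simp add: f coeff3_cst)
  qed
  have "(of_nat f :: fps3) * (X3 ^ p / fact p) * (Y3 ^ q / fact q) * (Z3 ^ r / fact r) =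
      cst (real f / (fact p * fact q * fact r)) * (X3 ^ p * Y3 ^ q * Z3 ^ r)"
    unfolding div cst_of_nat[symmetric] by (simp add: divide_inverse cst_arith mult_ac)
  moreover have "X3 ^ p * Y3 ^ q * Z3 ^ r = fps_const (fps_const (fps_X ^ r) * fps_X ^ q) * fps_X ^ p"
    by (simp add: X3_def Y3_def Z3_def fps_const_power mult_ac flip: fps_const_mult)
  moreover have "coeff3 (fps_const (fps_const (fps_X ^ r) * fps_X ^ q) * fps_X ^ p) a b c =
      (if a = p \<and> b = q \<and> c = r then 1 else 0)"
    by (simp add: coeff3_def fps_X_power_nth)
  ultimately show ?thesis
    by (simp only: coeff3_cst_mult) auto
qed

theorem theorem1p5:
  shows "fps3_has_sum
     (\<lambda>n. \<Sum>(m, k) \<in> {(m, k). 2 \<le> m \<and> m < k \<and> k \<le> 2 * n - 1}.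
        of_nat (eoc_pom_count (2 * n) m k)
        * (X3 ^ (2 * n - k - 1) / fact (2 * n - k - 1))
        * (Y3 ^ (k - m - 1) / fact (k - m - 1))
        * (Z3 ^ (m - 2) / fact (m - 2)))
     {2..}
     ((cos3 (2 * Y3) + 2 * cos3 (2 * (X3 - Z3)) - cos3 (2 * (Z3 + X3)))
      / (2 * cos3 (X3 + Y3 + Z3) ^ 3))"
  unfolding fps3_has_sum_def S_gf_0_eq
proof (intro allI)
  fix a b c
  let ?I = "\<lambda>n::nat. {(m, k). 2 \<le> m \<and> m < k \<and> k \<le> 2 * n - 1}"
  let ?T = "\<lambda>n. \<Sum>(m, k) \<in> ?I n.
        of_nat (eoc_pom_count (2 * n) m k)
        * (X3 ^ (2 * n - k - 1) / fact (2 * n - k - 1))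
        * (Y3 ^ (k - m - 1) / fact (k - m - 1))
        * (Z3 ^ (m - 2) / fact (m - 2))"
  have fin: "finite (?I n)" for n
    by (rule finite_subset[of _ "{..2 * n} \<times> {..2 * n}"]) auto
  \<comment> \<open>Fixed exponents determine m = c + 2 and k = b + c + 3, and then n through 2n = a
    + b + c + 4, so at most one n contributes.\<close>
  have T: "coeff3 (?T n) a b c = (if 2 * n = a + b + c + 4 then coeff3 (S_gf 0) a b c else 0)"
    if "n \<ge> 2" for n
  proof -
    have "coeff3 (?T n) a b c = (\<Sum>(m, k) \<in> ?I n. if a = 2 * n - k - 1 \<and> b = k - m - 1 \<and> c = m - 2
        then real (eoc_pom_count (2 * n) m k) / (fact a * fact b * fact c) else 0)"
      unfolding coeff3_sum by (intro sum.cong) (auto simp only: coeff3_monomial split: prod.splits)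
    also have "\<dots> = (\<Sum>p \<in> ?I n. if p = (c + 2, b + c + 3) \<and> 2 * n = a + b + c + 4
        then real (eoc_pom_count (2 * n) (c + 2) (b + c + 3)) / (fact a * fact b * fact c) else 0)"
      by (intro sum.cong refl) (auto split: prod.splits)
    also have "\<dots> = (if 2 * n = a + b + c + 4
        then real (eoc_pom_count (2 * n) (c + 2) (b + c + 3)) / (fact a * fact b * fact c) else 0)"
    proof (cases "2 * n = a + b + c + 4")
      case True
      then have mem: "(c + 2, b + c + 3) \<in> ?I n" by auto
      have "(\<Sum>p \<in> ?I n. if p = (c + 2, b + c + 3) then v else 0) = v" for v :: real
        by (subst sum.delta[OF fin]) (simp only: mem if_True)
      then show ?thesis using True by (simp only: simp_thms if_True)
    qed simp
    also have "\<dots> = (if 2 * n = a + b + c + 4 then coeff3 (S_gf 0) a b c else 0)"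
    proof (cases "2 * n = a + b + c + 4")
      case True
      then have "even (a + b + c)" by presburger
      then show ?thesis using S_gf_0_coeff[of a b c] True by (simp add: field_simps)
    qed simp
    finally show ?thesis .
  qed
  \<comment> \<open>Abstracting the coefficient to a function g leaves a sum with at most one
    nonzero term. If a + b + c is odd, the right-hand coefficient vanishes by parity, in accordance
    with the absence of a suitable n.\<close>
  have "finite {n \<in> {2..}. g n \<noteq> 0} \<and> coeff3 (S_gf 0) a b c = (\<Sum>n\<in>{n \<in> {2..}. g n \<noteq> 0}. g n)"
    if g: "\<And>n. n \<ge> 2 \<Longrightarrow> g n = (if 2 * n = a + b + c + 4 then coeff3 (S_gf 0) a b c else 0)"
    for g :: "nat \<Rightarrow> real"
  proof (cases "even (a + b + c) \<and> coeff3 (S_gf 0) a b c \<noteq> 0")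
    case True
    then obtain h where h: "a + b + c = 2 * h" by blast
    have "{n \<in> {2..}. g n \<noteq> 0} = {h + 2}"
      using g True by (auto simp: h split: if_splits)
    then show ?thesis using g[of "h + 2"] h by simp
  next
    case False
    have z: "coeff3 (S_gf 0) a b c = 0"
      using S_gf_0_coeff[of a b c] False by (auto split: if_splits)
    then have e: "{n \<in> {2..}. g n \<noteq> 0} = {}" using g by auto
    show ?thesis unfolding e by (simp add: z)
  qed
  from this[OF T] show "finite {n \<in> {2..}. coeff3 (?T n) a b c \<noteq> 0} \<and>
      coeff3 (S_gf 0) a b c = (\<Sum>n\<in>{n \<in> {2..}. coeff3 (?T n) a b c \<noteq> 0}. coeff3 (?T n) a b c)" .
qed

end
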